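(* Let $X,Y$ be smooth vector fields on the flag manifold $(\mathcal{F}^{\mathrm I},g^{\mathcal F})$. Then, for any $\beta=(\beta_i)_{1\le i\le r}\in\mathcal{F}^{\mathrm I}$, $$K^{\mathcal{F}^{\mathrm I}}_\beta(X,Y)=\frac1{16}\left(\left\|\Omega_\beta(X,Y)\right\|^2-\frac3{16}\left\|\sum_{i=1}^r[\![\,[\![\Omega_\beta(X,Y),\beta_i]\!],\beta_i]\!]\right\|^2\right),$$ where $$\Omega_\beta(X,Y)=\sum_{i,j=1}^r[\![\,[\![X_i(\beta),\beta_i]\!],\ [\![Y_j(\beta),\beta_j]\!]\,]\!]\in\mathfrak{so}(n).$$
   Context: $[\![A,B]\!]=AB-BA$ for $n\times n$ real matrices; on $\mathfrak{so}(n)$ (skew-symmetric matrices), $\|\Omega\|^2=\frac12\mathrm{tr}(\Omega^T\Omega)$. $K_\beta(X,Y)$ is the sectional curvature in the convention $K_\beta(X,Y)=g_\beta(R(X,Y)Y,X)$, $R(X,Y)Z=\nabla_X\nabla_YZ-\nabla_Y\nabla_XZ-\nabla_{[X,Y]}Z$, i.e. not divided by the squared area of the parallelogram spanned by $X(\beta),Y(\beta)$ (it is the usual sectional curvature when these are orthonormal). A type is $\mathrm I=(q_i)_{1\le i\le r}$, $r\ge2$, of positive integers with $\sum_iq_i=n$. For $1\le q\le n$, $G_q=\{P\in\mathbb{R}^{n\times n}:P^2=P,\ P^T=P,\ \mathrm{rank}(P)=q\}\subset\mathrm{Sym}_n$. The flag manifold is $\mathcal{F}^{\mathrm I}=\{(P_i)_{1\le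 i\le r}\in\prod_iG_{q_i}:P_iP_j=0\text{ for }i\ne j\}$. $SO(n)$ acts by $Q\cdot(P_i)_i=(QP_iQ^T)_i$. The standard flag is $\mathcal{P}_0=(P_0^i)_i$, with $P_0^i=\mathrm{Diag}[0_{q_1},\dots,I_{q_i},\dots,0_{q_r}]$; $\mathcal{F}^{\mathrm I}$ is its orbit, with isotropy group $SO(\mathrm I)=SO(n)\cap\prod_iO(q_i)$. $SO(n)$ carries the bi-invariant metric $g^O_Q(Q\Omega,Q\widetilde\Omega)=\frac12\mathrm{tr}(\Omega^T\widetilde\Omega)$, and $g^{\mathcal F}$ is the metric on $\mathcal{F}^{\mathrm I}$ for which the diffeomorphism $SO(n)/SO(\mathrm I)\to\mathcal{F}^{\mathrm I}$ induced by $Q\mapsto Q\cdot\mathcal{P}_0$ is an isometry, $SO(n)/SO(\mathrm I)$ having the quotient metric of $g^O$. Tangent vectors to $\mathcal{F}^{\mathrm I}$ are $r$-tuples of symmetric matrices; $X_i(\mathcal P)=(X(\mathcal P))_i$. *)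

theory Defs
  imports "HOL-Analysis.Analysis"
begin

text \<open>
  A submanifold is represented by its set \<open>S\<close> of points in a Euclidean space.  Functions,
  vector fields and connections on \<open>S\<close> are total functions on the ambient space; only their
  values at points of \<open>S\<close> are meaningful.
\<close>

primrec Ck_on :: "nat \<Rightarrow> 'a::euclidean_space set \<Rightarrow> ('a \<Rightarrow> 'b::euclidean_space) \<Rightarrow> bool" where
  "Ck_on 0 U f \<longleftrightarrow> continuous_on U f"
| "Ck_on (Suc k) U f \<longleftrightarrow>
     (\<forall>x\<in>U. f differentiable (at x)) \<and> (\<forall>v. Ck_on k U (\<lambda>x. frechet_derivative f (at x) v))"

text \<open>Meant for open \<open>U\<close> only.\<close>

definition smooth_on :: "'a::euclidean_space set \<Rightarrow> ('a \<Rightarrow> 'b::euclidean_space) \<Rightarrow> bool" where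
  "smooth_on U f \<longleftrightarrow> (\<forall>k. Ck_on k U f)"

text \<open>On an arbitrary set, a map is smooth if it locally extends to a smooth map on an open set.\<close>

definition smooth_map :: "'a::euclidean_space set \<Rightarrow> ('a \<Rightarrow> 'b::euclidean_space) \<Rightarrow> bool" where
  "smooth_map S f \<longleftrightarrow>
     (\<forall>p\<in>S. \<exists>U g. open U \<and> p \<in> U \<and> smooth_on U g \<and> (\<forall>x\<in>S \<inter> U. g x = f x))"

definition tangent_space :: "'a::euclidean_space set \<Rightarrow> 'a \<Rightarrow> 'a set" where
  "tangent_space S p =
     {v. \<exists>\<gamma> e. 0 < e \<and> smooth_on {-e<..<e} \<gamma> \<and> (\<forall>t\<in>{-e<..<e::real}. \<gamma> t \<in> S) \<and>
           \<gamma> 0 = p \<and> (\<gamma> has_vector_derivative v) (at 0)}"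

text \<open>
  The differential at \<open>p\<close> of a smooth map on \<open>S\<close>, applied to a tangent vector \<open>v\<close>.
  A derivative within \<open>S\<close> is in general not unique as a linear map on the ambient space, but
  all of them agree on \<open>tangent_space S p\<close>, the only vectors this is applied to.
\<close>

definition dmap :: "'a::euclidean_space set \<Rightarrow> ('a \<Rightarrow> 'b::euclidean_space) \<Rightarrow> 'a \<Rightarrow> 'a \<Rightarrow> 'b" where
  "dmap S f p v = frechet_derivative f (at p within S) v"

definition vector_field :: "'a::euclidean_space set \<Rightarrow> ('a \<Rightarrow> 'a) \<Rightarrow> bool" where
  "vector_field S X \<longleftrightarrow> smooth_map S X \<and> (\<forall>p\<in>S. X p \<in> tangent_space S p)"

definition derivation :: "'a::euclidean_space set \<Rightarrow> ('a \<Rightarrow> 'a) \<Rightarrow> ('a \<Rightarrow> real) \<Rightarrow> 'a \<Rightarrow> real" where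
  "derivation S X f = (\<lambda>p. dmap S f p (X p))"

definition is_lie_bracket ::
  "'a::euclidean_space set \<Rightarrow> ('a \<Rightarrow> 'a) \<Rightarrow> ('a \<Rightarrow> 'a) \<Rightarrow> ('a \<Rightarrow> 'a) \<Rightarrow> bool" where
  "is_lie_bracket S X Y Z \<longleftrightarrow> vector_field S Z \<and>
     (\<forall>f. smooth_map S f \<longrightarrow>
       (\<forall>p\<in>S. derivation S Z f p =
                derivation S X (derivation S Y f) p - derivation S Y (derivation S X f) p))"

definition lie_bracket ::
  "'a::euclidean_space set \<Rightarrow> ('a \<Rightarrow> 'a) \<Rightarrow> ('a \<Rightarrow> 'a) \<Rightarrow> 'a \<Rightarrow> 'a" where
  "lie_bracket S X Y = (SOME Z. is_lie_bracket S X Y Z)"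

text \<open>A Riemannian metric \<open>g\<close> on \<open>S\<close> is used as \<open>g p v w\<close>, for \<open>v\<close>, \<open>w\<close> in the tangent space at \<open>p\<close>.\<close>

definition affine_connection ::
  "'a::euclidean_space set \<Rightarrow> (('a \<Rightarrow> 'a) \<Rightarrow> ('a \<Rightarrow> 'a) \<Rightarrow> 'a \<Rightarrow> 'a) \<Rightarrow> bool" where
  "affine_connection S nabla \<longleftrightarrow>
     (\<forall>X Y. vector_field S X \<longrightarrow> vector_field S Y \<longrightarrow> vector_field S (nabla X Y)) \<and>
     (\<forall>X X' Y. vector_field S X \<longrightarrow> vector_field S X' \<longrightarrow> vector_field S Y \<longrightarrow>
       (\<forall>p\<in>S. nabla (\<lambda>x. X x + X' x) Y p = nabla X Y p + nabla X' Y p)) \<and>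
     (\<forall>f X Y. smooth_map S f \<longrightarrow> vector_field S X \<longrightarrow> vector_field S Y \<longrightarrow>
       (\<forall>p\<in>S. nabla (\<lambda>x. f x *\<^sub>R X x) Y p = f p *\<^sub>R nabla X Y p)) \<and>
     (\<forall>X Y Y'. vector_field S X \<longrightarrow> vector_field S Y \<longrightarrow> vector_field S Y' \<longrightarrow>
       (\<forall>p\<in>S. nabla X (\<lambda>x. Y x + Y' x) p = nabla X Y p + nabla X Y' p)) \<and>
     (\<forall>f X Y. smooth_map S f \<longrightarrow> vector_field S X \<longrightarrow> vector_field S Y \<longrightarrow>
       (\<forall>p\<in>S. nabla X (\<lambda>x. f x *\<^sub>R Y x) p = derivation S X f p *\<^sub>R Y p + f p *\<^sub>R nabla X Y p))"

definition is_levi_civita ::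
  "'a::euclidean_space set \<Rightarrow> ('a \<Rightarrow> 'a \<Rightarrow> 'a \<Rightarrow> real) \<Rightarrow>
   (('a \<Rightarrow> 'a) \<Rightarrow> ('a \<Rightarrow> 'a) \<Rightarrow> 'a \<Rightarrow> 'a) \<Rightarrow> bool" where
  "is_levi_civita S g nabla \<longleftrightarrow> affine_connection S nabla \<and>
     (\<forall>X Y. vector_field S X \<longrightarrow> vector_field S Y \<longrightarrow>
       (\<forall>p\<in>S. nabla X Y p - nabla Y X p = lie_bracket S X Y p)) \<and>
     (\<forall>X Y Z. vector_field S X \<longrightarrow> vector_field S Y \<longrightarrow> vector_field S Z \<longrightarrow>
       (\<forall>p\<in>S. derivation S X (\<lambda>x. g x (Y x) (Z x)) p =
                g p (nabla X Y p) (Z p) + g p (Y p) (nabla X Z p)))"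

text \<open>
  The Levi-Civita connection is unique only up to irrelevant values (away from \<open>S\<close>, or on
  functions that are not vector fields), hence \<open>SOME\<close> rather than \<open>THE\<close>; the same holds for
  \<open>lie_bracket\<close>.
\<close>

definition levi_civita ::
  "'a::euclidean_space set \<Rightarrow> ('a \<Rightarrow> 'a \<Rightarrow> 'a \<Rightarrow> real) \<Rightarrow> ('a \<Rightarrow> 'a) \<Rightarrow> ('a \<Rightarrow> 'a) \<Rightarrow> 'a \<Rightarrow> 'a" where
  "levi_civita S g = (SOME nabla. is_levi_civita S g nabla)"

definition riemann_curvature ::
  "'a::euclidean_space set \<Rightarrow> ('a \<Rightarrow> 'a \<Rightarrow> 'a \<Rightarrow> real) \<Rightarrow>
   ('a \<Rightarrow> 'a) \<Rightarrow> ('a \<Rightarrow> 'a) \<Rightarrow> ('a \<Rightarrow> 'a) \<Rightarrow> 'a \<Rightarrow> 'a" where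
  "riemann_curvature S g X Y Z =
     (let nabla = levi_civita S g in
      (\<lambda>p. nabla X (nabla Y Z) p - nabla Y (nabla X Z) p - nabla (lie_bracket S X Y) Z p))"

text \<open>Not divided by the squared area of the parallelogram spanned by \<open>X p\<close> and \<open>Y p\<close>.\<close>

definition sectional_curvature ::
  "'a::euclidean_space set \<Rightarrow> ('a \<Rightarrow> 'a \<Rightarrow> 'a \<Rightarrow> real) \<Rightarrow>
   ('a \<Rightarrow> 'a) \<Rightarrow> ('a \<Rightarrow> 'a) \<Rightarrow> 'a \<Rightarrow> real" where
  "sectional_curvature S g X Y p = g p (riemann_curvature S g X Y Y p) (X p)"

text \<open>
  For a surjective submersion \<open>f\<close> from \<open>(M, h)\<close> onto \<open>N\<close> such that \<open>h\<close> is invariant under a group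
  acting transitively on the fibres of \<open>f\<close>, \<open>quotient_metric M h f\<close> is the metric on \<open>N\<close> that
  makes \<open>f\<close> a Riemannian submersion: vectors at \<open>p\<close> are lifted to horizontal vectors at any
  point \<open>x\<close> over \<open>p\<close>.
\<close>

definition vertical_space ::
  "'a::euclidean_space set \<Rightarrow> ('a \<Rightarrow> 'b::euclidean_space) \<Rightarrow> 'a \<Rightarrow> 'a set" where
  "vertical_space M f x = {a \<in> tangent_space M x. dmap M f x a = 0}"

definition horizontal_space ::
  "'a::euclidean_space set \<Rightarrow> ('a \<Rightarrow> 'a \<Rightarrow> 'a \<Rightarrow> real) \<Rightarrow> ('a \<Rightarrow> 'b::euclidean_space) \<Rightarrow> 'a \<Rightarrow> 'a set" where
  "horizontal_space M h f x = {a \<in> tangent_space M x. \<forall>b \<in> vertical_space M f x. h x a b = 0}"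

definition quotient_metric ::
  "'a::euclidean_space set \<Rightarrow> ('a \<Rightarrow> 'a \<Rightarrow> 'a \<Rightarrow> real) \<Rightarrow> ('a \<Rightarrow> 'b::euclidean_space) \<Rightarrow>
   'b \<Rightarrow> 'b \<Rightarrow> 'b \<Rightarrow> real" where
  "quotient_metric M h f p v w =
     (THE c. \<exists>x\<in>M. \<exists>a\<in>horizontal_space M h f x. \<exists>b\<in>horizontal_space M h f x.
        f x = p \<and> dmap M f x a = v \<and> dmap M f x b = w \<and> c = h x a b)"

definition commutator :: "real^'n^'n \<Rightarrow> real^'n^'n \<Rightarrow> real^'n^'n" where
  "commutator A B = A ** B - B ** A"

definition skew_matrices :: "(real^'n^'n) set" where
  "skew_matrices = {A. transpose A = - A}"

definition skew_norm :: "real^'n^'n \<Rightarrow> real" where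
  "skew_norm A = sqrt (1/2 * trace (transpose A ** A))"

definition special_orthogonal :: "(real^'n^'n) set" where
  "special_orthogonal = {Q. rotation_matrix Q}"

text \<open>The tangent vectors \<open>Q ** A\<close>, \<open>Q ** B\<close> at \<open>Q\<close> have product \<open>1/2 * trace (transpose A ** B)\<close>.\<close>

definition SO_metric :: "real^'n^'n \<Rightarrow> real^'n^'n \<Rightarrow> real^'n^'n \<Rightarrow> real" where
  "SO_metric Q V W = 1/2 * trace (transpose (transpose Q ** V) ** (transpose Q ** W))"

text \<open>
  The index types \<open>'n\<close> and \<open>'r\<close> stand for \<open>{1..n}\<close> and \<open>{1..r}\<close> with their order, which is
  needed for the block structure of the standard flag.
\<close>

definition grassmannian :: "nat \<Rightarrow> (real^'n^'n) set" where
  "grassmannian q = {P. P ** P = P \<and> transpose P = P \<and> rank P = q}"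

definition flag_manifold :: "('r::finite \<Rightarrow> nat) \<Rightarrow> (real^'n^'n^'r) set" where
  "flag_manifold q =
     {P. (\<forall>i. P $ i \<in> grassmannian (q i)) \<and> (\<forall>i j. i \<noteq> j \<longrightarrow> P $ i ** P $ j = 0)}"

text \<open>The row indices of the \<open>i\<close>-th diagonal block; \<open>card {m. m < k}\<close> is the position of \<open>k\<close>, from 0.\<close>

definition block :: "('r::{finite,linorder} \<Rightarrow> nat) \<Rightarrow> 'r \<Rightarrow> ('n::{finite,linorder}) set" where
  "block q i = {k. (\<Sum>j | j < i. q j) \<le> card {m. m < k} \<and> card {m. m < k} < (\<Sum>j | j \<le> i. q j)}"

definition standard_flag ::
  "('r::{finite,linorder} \<Rightarrow> nat) \<Rightarrow>
   real^('n::{finite,linorder})^('n::{finite,linorder})^('r::{finite,linorder})" where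
  "standard_flag q = (\<chi> i. \<chi> k l. if k = l \<and> k \<in> block q i then 1 else 0)"

definition flag_action :: "real^'n^'n \<Rightarrow> real^'n^'n^('r::finite) \<Rightarrow> real^'n^'n^'r" where
  "flag_action Q P = (\<chi> i. Q ** P $ i ** transpose Q)"

definition flag_metric ::
  "('r::{finite,linorder} \<Rightarrow> nat) \<Rightarrow>
   real^('n::{finite,linorder})^('n::{finite,linorder})^('r::{finite,linorder}) \<Rightarrow>
   real^('n::{finite,linorder})^('n::{finite,linorder})^('r::{finite,linorder}) \<Rightarrow>
   real^('n::{finite,linorder})^('n::{finite,linorder})^('r::{finite,linorder}) \<Rightarrow> real" where
  "flag_metric q =
     quotient_metric special_orthogonal SO_metric (\<lambda>Q. flag_action Q (standard_flag q))"

definition flag_Omega ::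
  "(real^'n^'n^'r \<Rightarrow> real^'n^'n^'r) \<Rightarrow> (real^'n^'n^'r \<Rightarrow> real^'n^'n^'r) \<Rightarrow>
   real^'n^'n^('r::finite) \<Rightarrow> real^'n^'n" where
  "flag_Omega X Y \<beta> =
     (\<Sum>i\<in>UNIV. \<Sum>j\<in>UNIV.
        commutator (commutator (X \<beta> $ i) (\<beta> $ i)) (commutator (Y \<beta> $ j) (\<beta> $ j)))"

end

theory Submission
  imports Defs
begin

text \<open>
  A tangent vector at \<open>\<beta>\<close> is \<open>([A, \<beta>\<^sub>i])\<^sub>i\<close> for a unique skew matrix \<open>A\<close> whose diagonal blocks
  \<open>\<beta>\<^sub>i A \<beta>\<^sub>i\<close> vanish, and the inner product of two such tuples of matrices is four times the value of the
  quotient metric.  So the flag manifold carries a quarter of the metric induced from its ambient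
  Euclidean space: its Levi-Civita connection is the projected directional derivative, and its
  curvature is given by the Gauss equation.  The second fundamental form on tangent vectors with
  matrices \<open>A\<close>, \<open>B\<close> is \<open>([A, [B, \<beta>\<^sub>i]] + [B, [A, \<beta>\<^sub>i]])\<^sub>i / 2\<close>; the identity
  \<open>\<Sum>\<^sub>i [[B, \<beta>\<^sub>i], [A, \<beta>\<^sub>i]] = C + \<Sum>\<^sub>i \<beta>\<^sub>i C \<beta>\<^sub>i\<close> for \<open>C = [A, B]\<close> and \<open>\<Omega> = 4C\<close> then give the formula.
\<close>

subsection \<open>Smooth functions and symmetry of the second derivative\<close>

text \<open>Bracket, connection and quotient metric are picked by \<open>SOME\<close> and
  \<open>THE\<close>, so each needs existence and uniqueness before a formula for it can be used;
  and \<open>tangent_space\<close>, made of velocities of curves, is not known in advance to be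
  linear. Both difficulties are met by a smooth family of self-adjoint linear maps
  \<open>Pi x\<close> on the ambient space whose fixed vectors are exactly the tangent vectors at
  \<open>x\<close>. Its derivative in \<open>x\<close> is the second fundamental form, and the
  symmetry of that derivative takes the place of charts. For flags, put L(A) = ([A, P_i])_i. Its
  adjoint sends V to the sum of the [V_i, P_i], and the adjoint after L is multiplication by 2 on
  matrices with zero diagonal blocks. So half of L after its adjoint, applied to symmetrised tuples,
  is the projection, and it is quadratic in P. The same 2 gives the quarter: L(A) and L(B) have
  product 2 (A, B), whereas the group metric is (A, B)/2. All these sums collapse because the P_i
  add up to the identity. The definition of a flag does not state this; it is carried over from the
  standard flag by transitivity.\<close>

lemma Ck_on_subset: "Ck_on k U f \<Longrightarrow> V \<subseteq> U \<Longrightarrow> Ck_on k V f"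
  by (induction k arbitrary: f) (auto intro: continuous_on_subset)

lemma frechet_derivative_cong_open:
  assumes "open U" "x \<in> U" "\<And>y. y \<in> U \<Longrightarrow> f y = g y"
  shows "frechet_derivative f (at x) = frechet_derivative g (at x)"
proof -
  have "(f has_derivative D) (at x) \<longleftrightarrow> (g has_derivative D) (at x)" for D
    using assms by (metis has_derivative_transform_within_open)
  then show ?thesis
    by (simp add: frechet_derivative_def)
qed

lemma differentiable_cong_open:
  assumes "open U" "x \<in> U" "\<And>y. y \<in> U \<Longrightarrow> f y = g y"
  shows "f differentiable (at x) \<longleftrightarrow> g differentiable (at x)"
  using assms unfolding differentiable_def by (metis has_derivative_transform_within_open)

lemma Ck_on_cong:
  assumes "open U" "\<And>x. x \<in> U \<Longrightarrow> f x = g x"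
  shows "Ck_on k U f \<longleftrightarrow> Ck_on k U g"
  using assms(2)
proof (induction k arbitrary: f g)
  case 0
  then show ?case by (auto cong: continuous_on_cong)
next
  case (Suc k)
  have "Ck_on k U (\<lambda>x. frechet_derivative f (at x) v) \<longleftrightarrow>
        Ck_on k U (\<lambda>x. frechet_derivative g (at x) v)" for v
    using frechet_derivative_cong_open[OF assms(1) _ Suc.prems] by (intro Suc.IH) auto
  then show ?case
    using differentiable_cong_open[OF assms(1) _ Suc.prems] by auto
qed

lemma Ck_on_SucD: "Ck_on (Suc k) U f \<Longrightarrow> Ck_on k U f"
proof (induction k arbitrary: f)
  case 0
  then show ?case
    by (simp add: continuous_at_imp_continuous_on differentiable_imp_continuous_within)
next
  case (Suc k)
  have "Ck_on k U (\<lambda>x. frechet_derivative f (at x) v)" for v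
    by (rule Suc.IH[OF spec[OF conjunct2[OF iffD1[OF Ck_on.simps(2) Suc.prems]]]])
  then show ?case
    using Suc.prems by simp
qed

text \<open>Replaces the opaque \<open>frechet_derivative\<close> of the definition by an explicit
  derivative, so that the closure properties below become inductions on \<open>k\<close>.\<close>

lemma Ck_on_SucI:
  assumes "open U" "\<And>x. x \<in> U \<Longrightarrow> (f has_derivative F x) (at x)"
    and "\<And>v. Ck_on k U (\<lambda>x. F x v)"
  shows "Ck_on (Suc k) U f"
proof -
  have "frechet_derivative f (at x) = F x" if "x \<in> U" for x
    by (rule frechet_derivative_at[OF assms(2)[OF that], symmetric])
  then have "Ck_on k U (\<lambda>x. frechet_derivative f (at x) v)" for v
    using Ck_on_cong[OF assms(1), of "\<lambda>x. F x v" "\<lambda>x. frechet_derivative f (at x) v"] assms(3)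
    by auto
  then show ?thesis
    using assms(2) by (auto simp: differentiable_def)
qed

lemma Ck_on_SucE:
  assumes "Ck_on (Suc k) U f"
  shows "\<And>x. x \<in> U \<Longrightarrow> (f has_derivative frechet_derivative f (at x)) (at x)"
    and "\<And>v. Ck_on k U (\<lambda>x. frechet_derivative f (at x) v)"
  using assms by (auto simp: frechet_derivative_works)

lemma Ck_on_const: "Ck_on k U (\<lambda>x. c)"
  by (induction k arbitrary: c) auto

lemma Ck_on_linear:
  assumes "bounded_linear h"
  shows "Ck_on k U h"
proof (cases k)
  case 0
  then show ?thesis
    using linear_continuous_on[OF assms] by simp
next
  case (Suc m)
  have "frechet_derivative h (at x) = h" for x
    using frechet_derivative_at[OF bounded_linear_imp_has_derivative[OF assms]] by simp
  then show ?thesis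
    using Suc assms by (simp add: Ck_on_const bounded_linear_imp_differentiable)
qed

lemma Ck_on_linear_compose:
  assumes "open U" "bounded_linear h" "Ck_on k U f"
  shows "Ck_on k U (\<lambda>x. h (f x))"
  using assms(3)
proof (induction k arbitrary: f)
  case 0
  then show ?case
    using bounded_linear.continuous_on[OF assms(2)] by simp
next
  case (Suc k)
  note D = Ck_on_SucE[OF Suc.prems]
  show ?case
    using D Suc.IH
    by (intro Ck_on_SucI[OF assms(1), where F = "\<lambda>x v. h (frechet_derivative f (at x) v)"]
        bounded_linear.has_derivative[OF assms(2)]) auto
qed

lemma Ck_on_add:
  assumes "open U" "Ck_on k U f" "Ck_on k U g"
  shows "Ck_on k U (\<lambda>x. f x + g x)"
  using assms(2,3)
proof (induction k arbitrary: f g)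
  case 0
  then show ?case
    by (simp add: continuous_on_add)
next
  case (Suc k)
  note D = Ck_on_SucE[OF Suc.prems(1)] and E = Ck_on_SucE[OF Suc.prems(2)]
  show ?case
    using D E Suc.IH
    by (intro Ck_on_SucI[OF assms(1),
          where F = "\<lambda>x v. frechet_derivative f (at x) v + frechet_derivative g (at x) v"]
        has_derivative_add) auto
qed

lemma Ck_on_sum:
  assumes "open U" "\<And>i. i \<in> I \<Longrightarrow> Ck_on k U (f i)"
  shows "Ck_on k U (\<lambda>x. \<Sum>i\<in>I. f i x)"
  using assms(2)
  by (induction I rule: infinite_finite_induct) (auto intro: Ck_on_const Ck_on_add[OF assms(1)])

lemma Ck_on_bilinear:
  assumes "open U" "bounded_bilinear b" "Ck_on k U f" "Ck_on k U g"
  shows "Ck_on k U (\<lambda>x. b (f x) (g x))"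
  using assms(3,4)
proof (induction k arbitrary: f g)
  case 0
  then show ?case
    using bounded_bilinear.continuous_on[OF assms(2)] by simp
next
  case (Suc k)
  note D = Ck_on_SucE[OF Suc.prems(1)] and E = Ck_on_SucE[OF Suc.prems(2)]
  show ?case
  proof (rule Ck_on_SucI[OF assms(1)])
    show "((\<lambda>x. b (f x) (g x)) has_derivative
      (\<lambda>v. b (f x) (frechet_derivative g (at x) v) + b (frechet_derivative f (at x) v) (g x))) (at x)"
      if "x \<in> U" for x
      using bounded_bilinear.FDERIV[OF assms(2) D(1) E(1)] that by blast
    show "Ck_on k U
      (\<lambda>x. b (f x) (frechet_derivative g (at x) v) + b (frechet_derivative f (at x) v) (g x))" for v
      \<comment> \<open>Each product pairs a derivative, of class \<open>k\<close>, with an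
        undifferentiated factor, whose class must first be lowered to \<open>k\<close>.\<close>
      using D(2) E(2) Ck_on_SucD[OF Suc.prems(1)] Ck_on_SucD[OF Suc.prems(2)]
      by (intro Ck_on_add[OF assms(1)] Suc.IH) simp_all
  qed
qed

text \<open>The family of these combinations is closed under differentiation, so one induction with
  \<open>a\<close> and \<open>b\<close> arbitrary treats sine and cosine together.\<close>

lemma Ck_on_sin_cos: "Ck_on k U (\<lambda>t::real. a * cos (c * t) + b * sin (c * t))" if "open U"
proof (induction k arbitrary: a b)
  case 0
  show ?case
    by (auto intro!: continuous_intros)
next
  case (Suc k)
  show ?case
  proof (rule Ck_on_SucI[OF that])
    show "((\<lambda>t. a * cos (c * t) + b * sin (c * t)) has_derivative
        (\<lambda>v. (b * c * v) * cos (c * x) + (- (a * c * v)) * sin (c * x))) (at x)" for x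
      by (auto intro!: derivative_eq_intros simp: algebra_simps)
  qed (rule Suc.IH)
qed

lemma smooth_onD:
  assumes "smooth_on U f"
  shows "\<And>x. x \<in> U \<Longrightarrow> (f has_derivative frechet_derivative f (at x)) (at x)"
    and "\<And>v. smooth_on U (\<lambda>x. frechet_derivative f (at x) v)"
    and "continuous_on U f"
  using assms Ck_on_SucE[of _ U f] unfolding smooth_on_def by (blast, blast, metis Ck_on.simps(1))

lemma smooth_on_subset: "smooth_on U f \<Longrightarrow> V \<subseteq> U \<Longrightarrow> smooth_on V f"
  unfolding smooth_on_def by (blast intro: Ck_on_subset)

lemma smooth_on_bilinear:
  "open U \<Longrightarrow> bounded_bilinear b \<Longrightarrow> smooth_on U f \<Longrightarrow> smooth_on U g \<Longrightarrow> smooth_on U (\<lambda>x. b (f x) (g x))"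
  unfolding smooth_on_def by (blast intro: Ck_on_bilinear)

lemma smooth_on_linear_compose:
  "open U \<Longrightarrow> bounded_linear h \<Longrightarrow> smooth_on U f \<Longrightarrow> smooth_on U (\<lambda>x. h (f x))"
  unfolding smooth_on_def by (blast intro: Ck_on_linear_compose)

lemma smooth_on_add:
  "open U \<Longrightarrow> smooth_on U f \<Longrightarrow> smooth_on U g \<Longrightarrow> smooth_on U (\<lambda>x. f x + g x)"
  unfolding smooth_on_def by (blast intro: Ck_on_add)

lemma smooth_on_sum:
  "open U \<Longrightarrow> (\<And>i. i \<in> I \<Longrightarrow> smooth_on U (f i)) \<Longrightarrow> smooth_on U (\<lambda>x. \<Sum>i\<in>I. f i x)"
  unfolding smooth_on_def by (blast intro: Ck_on_sum)

lemma smooth_on_const: "smooth_on U (\<lambda>x. c)"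
  unfolding smooth_on_def by (blast intro: Ck_on_const)

lemma smooth_on_linear: "bounded_linear h \<Longrightarrow> smooth_on U h"
  unfolding smooth_on_def by (blast intro: Ck_on_linear)

lemma linear_basis_expansion:
  assumes "linear h"
  shows "h v = (\<Sum>b\<in>Basis. (v \<bullet> b) *\<^sub>R h b)"
  by (subst euclidean_representation[of v, symmetric])
     (simp only: linear_sum[OF assms] linear_cmul[OF assms])

text \<open>\<open>Ck_on\<close> controls derivatives in constant directions only; the varying
  direction \<open>Y x\<close> is therefore expanded in \<open>Basis\<close>.\<close>

lemma smooth_on_frechet_derivative_apply:
  assumes "open U" "smooth_on U f" "smooth_on U Y"
  shows "smooth_on U (\<lambda>x. frechet_derivative f (at x) (Y x))"
proof -
  have *: "frechet_derivative f (at x) (Y x) =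
      (\<Sum>b\<in>Basis. (Y x \<bullet> b) *\<^sub>R frechet_derivative f (at x) b)" if "x \<in> U" for x
    using smooth_onD(1)[OF assms(2) that]
    by (intro linear_basis_expansion) (rule has_derivative_linear)
  have "smooth_on U (\<lambda>x. \<Sum>b\<in>Basis. (Y x \<bullet> b) *\<^sub>R frechet_derivative f (at x) b)"
    by (intro smooth_on_sum smooth_on_bilinear[OF _ bounded_bilinear_scaleR]
        smooth_on_linear_compose[OF _ bounded_linear_inner_left] assms smooth_onD(2)[OF assms(2)])
  then show ?thesis
    using * Ck_on_cong[OF assms(1)] unfolding smooth_on_def by (metis (no_types, lifting))
qed

text \<open>Two applications of the mean value theorem to the mixed second difference of \<open>f\<close>.\<close>

lemma second_difference_mvt:
  fixes f :: "'a::euclidean_space \<Rightarrow> real"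
  assumes "0 < h"
    and in_U: "\<And>s t. 0 \<le> s \<Longrightarrow> s \<le> h \<Longrightarrow> 0 \<le> t \<Longrightarrow> t \<le> h \<Longrightarrow> x + s *\<^sub>R u + t *\<^sub>R v \<in> U"
    and f': "\<And>y. y \<in> U \<Longrightarrow> (f has_derivative F y) (at y)"
    and f'': "\<And>y. y \<in> U \<Longrightarrow> ((\<lambda>y. F y u) has_derivative G y) (at y)"
  obtains s t where "0 \<le> s" "s \<le> h" "0 \<le> t" "t \<le> h"
    and "f (x + h *\<^sub>R u + h *\<^sub>R v) - f (x + h *\<^sub>R u) - f (x + h *\<^sub>R v) + f x
           = h * h * G (x + s *\<^sub>R u + t *\<^sub>R v) v"
proof -
  let ?\<phi> = "\<lambda>s. f (x + s *\<^sub>R u + h *\<^sub>R v) - f (x + s *\<^sub>R u + 0 *\<^sub>R v)"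
  have line: "((\<lambda>s. f (x + s *\<^sub>R u + t *\<^sub>R v)) has_real_derivative F (x + s *\<^sub>R u + t *\<^sub>R v) u) (at s)"
    if "0 \<le> s" "s \<le> h" "0 \<le> t" "t \<le> h" for s t
  proof -
    have "((\<lambda>s. x + s *\<^sub>R u + t *\<^sub>R v) has_derivative (\<lambda>d. d *\<^sub>R u)) (at s)"
      by (auto intro!: derivative_eq_intros)
    from has_derivative_compose[OF this f'[OF in_U[OF that]]]
    have D: "((\<lambda>s. f (x + s *\<^sub>R u + t *\<^sub>R v)) has_derivative
        (\<lambda>d. F (x + s *\<^sub>R u + t *\<^sub>R v) (d *\<^sub>R u))) (at s)" .
    have "linear (F (x + s *\<^sub>R u + t *\<^sub>R v))"
      using f'[OF in_U[OF that]] by (rule has_derivative_linear)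
    then have "(\<lambda>d. F (x + s *\<^sub>R u + t *\<^sub>R v) (d *\<^sub>R u)) = (*) (F (x + s *\<^sub>R u + t *\<^sub>R v) u)"
      by (simp add: fun_eq_iff linear_cmul)
    with D show ?thesis
      by (simp add: has_field_derivative_def)
  qed
  have "\<exists>s>0. s < h \<and> ?\<phi> h - ?\<phi> 0 =
      (h - 0) * (F (x + s *\<^sub>R u + h *\<^sub>R v) u - F (x + s *\<^sub>R u + 0 *\<^sub>R v) u)"
  proof (rule MVT2[OF assms(1)])
    show "(?\<phi> has_real_derivative F (x + s *\<^sub>R u + h *\<^sub>R v) u - F (x + s *\<^sub>R u + 0 *\<^sub>R v) u) (at s)"
      if "0 \<le> s" "s \<le> h" for s
      using that assms(1) by (intro DERIV_diff line) simp_all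
  qed
  then obtain s where s: "0 < s" "s < h"
    and \<phi>: "?\<phi> h - ?\<phi> 0 = h * (F (x + s *\<^sub>R u + h *\<^sub>R v) u - F (x + s *\<^sub>R u + 0 *\<^sub>R v) u)"
    by auto
  have line': "((\<lambda>t. F (x + s *\<^sub>R u + t *\<^sub>R v) u) has_real_derivative G (x + s *\<^sub>R u + t *\<^sub>R v) v) (at t)"
    if "0 \<le> t" "t \<le> h" for t
  proof -
    have y: "x + s *\<^sub>R u + t *\<^sub>R v \<in> U"
      using in_U s that by simp
    have "((\<lambda>t. x + s *\<^sub>R u + t *\<^sub>R v) has_derivative (\<lambda>d. d *\<^sub>R v)) (at t)"
      by (auto intro!: derivative_eq_intros)
    from has_derivative_compose[OF this f''[OF y]]
    have D: "((\<lambda>t. F (x + s *\<^sub>R u + t *\<^sub>R v) u) has_derivative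
        (\<lambda>d. G (x + s *\<^sub>R u + t *\<^sub>R v) (d *\<^sub>R v))) (at t)" .
    have "linear (G (x + s *\<^sub>R u + t *\<^sub>R v))"
      using f''[OF y] by (rule has_derivative_linear)
    then have "(\<lambda>d. G (x + s *\<^sub>R u + t *\<^sub>R v) (d *\<^sub>R v)) = (*) (G (x + s *\<^sub>R u + t *\<^sub>R v) v)"
      by (simp add: fun_eq_iff linear_cmul)
    with D show ?thesis
      by (simp add: has_field_derivative_def)
  qed
  have "\<exists>t>0. t < h \<and> F (x + s *\<^sub>R u + h *\<^sub>R v) u - F (x + s *\<^sub>R u + 0 *\<^sub>R v) u =
      (h - 0) * G (x + s *\<^sub>R u + t *\<^sub>R v) v"
    by (rule MVT2[OF assms(1)]) (rule line')
  then obtain t where t: "0 < t" "t < h"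
    and "F (x + s *\<^sub>R u + h *\<^sub>R v) u - F (x + s *\<^sub>R u + 0 *\<^sub>R v) u = h * G (x + s *\<^sub>R u + t *\<^sub>R v) v"
    by auto
  with \<phi> s t that[of s t] show thesis
    by (simp add: algebra_simps)
qed

text \<open>The mixed second difference is symmetric in \<open>u\<close> and \<open>v\<close>.
  Evaluated in both orders it equates \<open>G u\<close> and \<open>G v\<close> at two points near
  \<open>x\<close>; if the values at \<open>x\<close> were 2e apart, continuity would keep these two
  apart as well.\<close>

lemma symmetric_second_derivative_real:
  fixes f :: "'a::euclidean_space \<Rightarrow> real"
  assumes "open U" "x \<in> U"
    and f': "\<And>y. y \<in> U \<Longrightarrow> (f has_derivative F y) (at y)"
    and f'': "\<And>w y. y \<in> U \<Longrightarrow> ((\<lambda>y. F y w) has_derivative G w y) (at y)"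
    and cont: "\<And>w z. continuous_on U (\<lambda>y. G w y z)"
  shows "G u x v = G v x u"
proof (rule ccontr)
  assume ne: "G u x v \<noteq> G v x u"
  define e where "e = \<bar>G u x v - G v x u\<bar> / 2"
  have "e > 0"
    using ne by (simp add: e_def)
  have "\<exists>d>0. ball x d \<subseteq> U \<and> (\<forall>y\<in>ball x d. \<bar>G w y z - G w x z\<bar> < e)" for w z
  proof -
    from cont[of w z] assms(1,2) have "isCont (\<lambda>y. G w y z) x"
      by (simp add: continuous_on_eq_continuous_at)
    then have "\<forall>\<^sub>F y in nhds x. dist (G w y z) (G w x z) < e"
      using \<open>e > 0\<close> by (simp add: isCont_def tendsto_iff eventually_at_filter eventually_nhds)
        (metis dist_self)
    moreover have "\<forall>\<^sub>F y in nhds x. y \<in> U"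
      using assms(1,2) by (simp add: eventually_nhds_in_open)
    ultimately have "\<forall>\<^sub>F y in nhds x. y \<in> U \<and> \<bar>G w y z - G w x z\<bar> < e"
      by eventually_elim (simp add: dist_real_def)
    then show ?thesis
      unfolding eventually_nhds_metric by (auto simp: subset_iff dist_commute)
  qed
  then obtain d1 d2 where "d1 > 0" "d2 > 0" "ball x d1 \<subseteq> U"
    and d1: "\<And>y. y \<in> ball x d1 \<Longrightarrow> \<bar>G u y v - G u x v\<bar> < e"
    and d2: "\<And>y. y \<in> ball x d2 \<Longrightarrow> \<bar>G v y u - G v x u\<bar> < e"
    by metis
  define d where "d = min d1 d2"
  \<comment> \<open>Small enough for the parallelogram spanned by \<open>h *\<^sub>R u\<close> and
    \<open>h *\<^sub>R v\<close> to stay in the ball; the summand 1 keeps the denominator positive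
    when both vectors vanish.\<close>
  define h where "h = d / (2 * (norm u + norm v + 1))"
  have d: "0 < d" "ball x d \<subseteq> U"
    using \<open>d1 > 0\<close> \<open>d2 > 0\<close> \<open>ball x d1 \<subseteq> U\<close> by (auto simp: d_def)
  have N: "0 < norm u + norm v + 1"
    using norm_ge_zero[of u] norm_ge_zero[of v] by linarith
  then have h: "0 < h"
    using d by (simp add: h_def)
  have near: "x + s *\<^sub>R u + t *\<^sub>R v \<in> ball x d" "x + s *\<^sub>R v + t *\<^sub>R u \<in> ball x d"
    if "0 \<le> s" "s \<le> h" "0 \<le> t" "t \<le> h" for s t
  proof -
    have "h * (norm u + norm v) < d"
    proof -
      have "h * (norm u + norm v) \<le> h * (norm u + norm v + 1)"
        using h by simp
      also have "\<dots> = d / 2"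
        using N by (simp add: h_def field_simps)
      finally show ?thesis
        using d by linarith
    qed
    moreover have "norm (a *\<^sub>R y + b *\<^sub>R z) \<le> h * (norm y + norm z)"
      if "0 \<le> a" "a \<le> h" "0 \<le> b" "b \<le> h" for a b and y z :: 'a
    proof -
      have "norm (a *\<^sub>R y + b *\<^sub>R z) \<le> a * norm y + b * norm z"
        using norm_triangle_ineq[of "a *\<^sub>R y" "b *\<^sub>R z"] that by simp
      also have "\<dots> \<le> h * norm y + h * norm z"
        using that by (intro add_mono mult_right_mono) auto
      finally show ?thesis
        by (simp add: algebra_simps)
    qed
    from this[OF that, of u v] this[OF that, of v u]
    have "norm (s *\<^sub>R u + t *\<^sub>R v) \<le> h * (norm u + norm v)"
      "norm (s *\<^sub>R v + t *\<^sub>R u) \<le> h * (norm u + norm v)"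
      by (simp_all add: algebra_simps)
    moreover have "y \<in> ball x d" if "norm (y - x) < d" for y
      using that by (simp add: dist_norm norm_minus_commute)
    ultimately show "x + s *\<^sub>R u + t *\<^sub>R v \<in> ball x d" "x + s *\<^sub>R v + t *\<^sub>R u \<in> ball x d"
      by (simp_all add: add.assoc)
  qed
  obtain s t where st: "0 \<le> s" "s \<le> h" "0 \<le> t" "t \<le> h"
    and eq1: "f (x + h *\<^sub>R u + h *\<^sub>R v) - f (x + h *\<^sub>R u) - f (x + h *\<^sub>R v) + f x
           = h * h * G u (x + s *\<^sub>R u + t *\<^sub>R v) v"
    using second_difference_mvt[of h x u v U f F "G u"] h near d f' f'' by blast
  obtain s' t' where st': "0 \<le> s'" "s' \<le> h" "0 \<le> t'" "t' \<le> h"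
    and eq2: "f (x + h *\<^sub>R v + h *\<^sub>R u) - f (x + h *\<^sub>R v) - f (x + h *\<^sub>R u) + f x
           = h * h * G v (x + s' *\<^sub>R v + t' *\<^sub>R u) u"
    using second_difference_mvt[of h x v u U f F "G v"] h near d f' f'' by blast
  have "G u (x + s *\<^sub>R u + t *\<^sub>R v) v = G v (x + s' *\<^sub>R v + t' *\<^sub>R u) u"
  proof -
    have comm: "x + h *\<^sub>R v + h *\<^sub>R u = x + h *\<^sub>R u + h *\<^sub>R v"
      by simp
    have "h * h * G u (x + s *\<^sub>R u + t *\<^sub>R v) v = h * h * G v (x + s' *\<^sub>R v + t' *\<^sub>R u) u"
      using eq1 eq2[unfolded comm] by linarith
    then show ?thesis
      using h by simp
  qed
  moreover have "\<bar>G u (x + s *\<^sub>R u + t *\<^sub>R v) v - G u x v\<bar> < e"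
    using near(1)[OF st] by (intro d1) (simp add: d_def)
  moreover have "\<bar>G v (x + s' *\<^sub>R v + t' *\<^sub>R u) u - G v x u\<bar> < e"
    using near(2)[OF st'] by (intro d2) (simp add: d_def)
  ultimately show False
    unfolding e_def by (simp add: abs_if split: if_splits)
qed

lemma symmetric_second_derivative:
  fixes f :: "'a::euclidean_space \<Rightarrow> 'b::euclidean_space"
  assumes U: "open U" "x \<in> U" and f: "smooth_on U f"
  shows "frechet_derivative (\<lambda>y. frechet_derivative f (at y) u) (at x) v =
         frechet_derivative (\<lambda>y. frechet_derivative f (at y) v) (at x) u"
proof (rule euclidean_eqI)
  fix b :: 'b
  let ?F = "\<lambda>y w. frechet_derivative f (at y) w \<bullet> b"
  let ?G = "\<lambda>w y z. frechet_derivative (\<lambda>y. frechet_derivative f (at y) w) (at y) z \<bullet> b"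
  note D = smooth_onD[OF f]
  note D2 = smooth_onD[OF D(2)]
  have "?G u x v = ?G v x u"
  proof (rule symmetric_second_derivative_real[OF U, of "\<lambda>y. f y \<bullet> b" ?F])
    show "((\<lambda>y. f y \<bullet> b) has_derivative ?F y) (at y)" if "y \<in> U" for y
      using D(1)[OF that] by (rule has_derivative_inner_left)
    show "((\<lambda>y. ?F y w) has_derivative ?G w y) (at y)" if "y \<in> U" for w y
      using D2(1)[OF that] by (rule has_derivative_inner_left)
    show "continuous_on U (\<lambda>y. ?G w y z)" for w z
      by (intro continuous_intros smooth_onD(3)[OF D2(2)])
  qed
  then show "frechet_derivative (\<lambda>y. frechet_derivative f (at y) u) (at x) v \<bullet> b =
         frechet_derivative (\<lambda>y. frechet_derivative f (at y) v) (at x) u \<bullet> b" .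
qed

subsection \<open>Smooth maps on submanifolds\<close>

lemma smooth_mapE:
  assumes "smooth_map S f" "p \<in> S"
  obtains U g where "open U" "p \<in> U" "smooth_on U g" "\<And>x. x \<in> S \<Longrightarrow> x \<in> U \<Longrightarrow> g x = f x"
proof -
  have "\<exists>U g. open U \<and> p \<in> U \<and> smooth_on U g \<and> (\<forall>x\<in>S \<inter> U. g x = f x)"
    using assms by (simp add: smooth_map_def)
  then obtain U g where "open U \<and> p \<in> U \<and> smooth_on U g \<and> (\<forall>x\<in>S \<inter> U. g x = f x)"
    by (elim exE)
  then show thesis
    by (intro that[of U g]) simp_all
qed

lemma smooth_mapI:
  assumes "\<And>p. p \<in> S \<Longrightarrow>
    \<exists>U g. open U \<and> p \<in> U \<and> smooth_on U g \<and> (\<forall>x\<in>S \<inter> U. g x = f x)"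
  shows "smooth_map S f"
  using assms by (simp add: smooth_map_def)

lemma smooth_map_cong: "(\<And>x. x \<in> S \<Longrightarrow> f x = g x) \<Longrightarrow> smooth_map S f \<longleftrightarrow> smooth_map S g"
  by (simp add: smooth_map_def)

lemma smooth_map_linear_compose:
  assumes "bounded_linear h" "smooth_map S f"
  shows "smooth_map S (\<lambda>x. h (f x))"
proof (rule smooth_mapI)
  fix p assume p: "p \<in> S"
  obtain U g where "open U" "p \<in> U" "smooth_on U g" "\<And>x. x \<in> S \<Longrightarrow> x \<in> U \<Longrightarrow> g x = f x"
    using smooth_mapE[OF assms(2) p] by blast
  then show "\<exists>U g. open U \<and> p \<in> U \<and> smooth_on U g \<and> (\<forall>x\<in>S \<inter> U. g x = h (f x))"
    using smooth_on_linear_compose[OF _ assms(1), of U g]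
    by (intro exI[of _ U] exI[of _ "\<lambda>x. h (g x)"]) simp
qed

lemma smooth_map_bilinear:
  assumes "bounded_bilinear b" "smooth_map S f" "smooth_map S g"
  shows "smooth_map S (\<lambda>x. b (f x) (g x))"
proof (rule smooth_mapI)
  fix p assume p: "p \<in> S"
  obtain U f' where U: "open U" "p \<in> U" "smooth_on U f'" "\<And>x. x \<in> S \<Longrightarrow> x \<in> U \<Longrightarrow> f' x = f x"
    using smooth_mapE[OF assms(2) p] by blast
  obtain V g' where V: "open V" "p \<in> V" "smooth_on V g'" "\<And>x. x \<in> S \<Longrightarrow> x \<in> V \<Longrightarrow> g' x = g x"
    using smooth_mapE[OF assms(3) p] by blast
  have "smooth_on (U \<inter> V) (\<lambda>x. b (f' x) (g' x))"
    using U V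
    by (intro smooth_on_bilinear[OF _ assms(1) smooth_on_subset[OF U(3)] smooth_on_subset[OF V(3)]]) auto
  then show "\<exists>U h. open U \<and> p \<in> U \<and> smooth_on U h \<and> (\<forall>x\<in>S \<inter> U. h x = b (f x) (g x))"
    using U V by (intro exI[of _ "U \<inter> V"] exI[of _ "\<lambda>x. b (f' x) (g' x)"]) auto
qed

lemma smooth_map_add:
  assumes "smooth_map S f" "smooth_map S g"
  shows "smooth_map S (\<lambda>x. f x + g x)"
proof (rule smooth_mapI)
  fix p assume p: "p \<in> S"
  obtain U f' where U: "open U" "p \<in> U" "smooth_on U f'" "\<And>x. x \<in> S \<Longrightarrow> x \<in> U \<Longrightarrow> f' x = f x"
    using smooth_mapE[OF assms(1) p] by blast
  obtain V g' where V: "open V" "p \<in> V" "smooth_on V g'" "\<And>x. x \<in> S \<Longrightarrow> x \<in> V \<Longrightarrow> g' x = g x"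
    using smooth_mapE[OF assms(2) p] by blast
  have "smooth_on (U \<inter> V) (\<lambda>x. f' x + g' x)"
    using U V by (intro smooth_on_add smooth_on_subset[OF U(3)] smooth_on_subset[OF V(3)]) auto
  then show "\<exists>U h. open U \<and> p \<in> U \<and> smooth_on U h \<and> (\<forall>x\<in>S \<inter> U. h x = f x + g x)"
    using U V by (intro exI[of _ "U \<inter> V"] exI[of _ "\<lambda>x. f' x + g' x"]) auto
qed

lemma smooth_map_const: "smooth_map S (\<lambda>x. c)"
  using smooth_on_const by (auto simp: smooth_map_def)

lemma smooth_map_linear: "bounded_linear h \<Longrightarrow> smooth_map S h"
  using smooth_on_linear by (auto simp: smooth_map_def)

lemma smooth_map_sum:
  assumes "\<And>i. i \<in> I \<Longrightarrow> smooth_map S (f i)"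
  shows "smooth_map S (\<lambda>x. \<Sum>i\<in>I. f i x)"
  using assms
  by (induction I rule: infinite_finite_induct) (auto intro: smooth_map_const smooth_map_add)

lemma smooth_map_diff:
  assumes "smooth_map S f" "smooth_map S g"
  shows "smooth_map S (\<lambda>x. f x - g x)"
  using smooth_map_add[OF assms(1)
      smooth_map_linear_compose[OF bounded_linear_minus[OF bounded_linear_ident] assms(2)]]
  by simp

lemma smooth_map_has_derivative:
  assumes "smooth_map S f" "p \<in> S"
  shows "(f has_derivative frechet_derivative f (at p within S)) (at p within S)"
proof -
  obtain U g where U: "open U" "p \<in> U" "smooth_on U g" "\<And>x. x \<in> S \<Longrightarrow> x \<in> U \<Longrightarrow> g x = f x"
    using smooth_mapE[OF assms] by blast
  have "(g has_derivative frechet_derivative g (at p)) (at p within S)"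
    using smooth_onD(1)[OF U(3,2)] by (rule has_derivative_at_withinI)
  then have "(f has_derivative frechet_derivative g (at p)) (at p within S)"
  proof (rule has_derivative_transform_eventually)
    show "\<forall>\<^sub>F x in at p within S. g x = f x"
      using eventually_at_topological U by blast
  qed (use U assms(2) in auto)
  then show ?thesis
    using frechet_derivative_works differentiable_def by blast
qed

lemma tangent_space_in: "v \<in> tangent_space S p \<Longrightarrow> p \<in> S"
  unfolding tangent_space_def by force

lemma tangent_curve_derivative:
  assumes "\<And>t. t \<in> {-e<..<e} \<Longrightarrow> \<gamma> t \<in> S" "0 < e" "(\<gamma> has_vector_derivative v) (at (0::real))"
    and "(f has_derivative F) (at (\<gamma> 0) within S)"
  shows "((\<lambda>t. f (\<gamma> t)) has_vector_derivative F v) (at 0)"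
proof -
  let ?T = "{-e<..<e}"
  have "(\<gamma> has_derivative (\<lambda>h. h *\<^sub>R v)) (at 0 within ?T)"
    using assms(3) by (simp add: has_vector_derivative_def has_derivative_at_withinI)
  moreover have "(f has_derivative F) (at (\<gamma> 0) within \<gamma> ` ?T)"
    using assms(1) by (intro has_derivative_subset[OF assms(4)]) auto
  ultimately have "((\<lambda>t. f (\<gamma> t)) has_derivative (\<lambda>h. F (h *\<^sub>R v))) (at 0 within ?T)"
    by (rule has_derivative_in_compose)
  moreover have "at 0 within ?T = at 0"
    using assms(2) by (intro at_within_open) auto
  moreover have "F (h *\<^sub>R v) = h *\<^sub>R F v" for h
    using linear_cmul[OF has_derivative_linear[OF assms(4)]] .
  ultimately show ?thesis
    by (simp add: has_vector_derivative_def)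
qed

text \<open>Any two derivatives within \<open>S\<close> agree on \<open>v\<close>, because both give
  the velocity of the image under \<open>f\<close> of one curve in \<open>S\<close> with velocity
  \<open>v\<close>.\<close>

lemma dmap_eq:
  assumes "v \<in> tangent_space S p" "(f has_derivative F) (at p within S)"
  shows "dmap S f p v = F v"
proof -
  obtain \<gamma> e where \<gamma>: "0 < e" "\<And>t. t \<in> {-e<..<e::real} \<Longrightarrow> \<gamma> t \<in> S" "\<gamma> 0 = p"
    "(\<gamma> has_vector_derivative v) (at 0)"
    using assms(1) unfolding tangent_space_def by blast
  have "(f has_derivative frechet_derivative f (at p within S)) (at p within S)"
    using assms(2) frechet_derivative_works differentiable_def by blast
  with \<gamma> assms(2) have "((\<lambda>t. f (\<gamma> t)) has_vector_derivative dmap S f p v) (at 0)"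
    "((\<lambda>t. f (\<gamma> t)) has_vector_derivative F v) (at 0)"
    unfolding dmap_def by (blast intro: tangent_curve_derivative)+
  then show ?thesis
    by (rule vector_derivative_unique_at)
qed

lemma smooth_map_has_dmap:
  "smooth_map S f \<Longrightarrow> p \<in> S \<Longrightarrow> (f has_derivative dmap S f p) (at p within S)"
  unfolding dmap_def[abs_def] by (simp add: smooth_map_has_derivative)

lemma linear_dmap: "smooth_map S f \<Longrightarrow> p \<in> S \<Longrightarrow> linear (dmap S f p)"
  using smooth_map_has_dmap by (rule has_derivative_linear)

lemma dmap_cong:
  assumes "p \<in> S" "\<And>x. x \<in> S \<Longrightarrow> f x = g x"
  shows "dmap S f p = dmap S g p"
proof -
  have "(f has_derivative D) (at p within S) \<longleftrightarrow> (g has_derivative D) (at p within S)" for D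
    using assms by (metis has_derivative_transform)
  then show ?thesis
    by (simp add: dmap_def[abs_def] frechet_derivative_def)
qed

lemma dmap_extension:
  assumes "open U" "smooth_on U g" "p \<in> U" "\<And>x. x \<in> S \<Longrightarrow> x \<in> U \<Longrightarrow> g x = f x"
    and "v \<in> tangent_space S p"
  shows "dmap S f p v = frechet_derivative g (at p) v"
proof (rule dmap_eq[OF assms(5)])
  have "(g has_derivative frechet_derivative g (at p)) (at p within S)"
    using smooth_onD(1)[OF assms(2,3)] by (rule has_derivative_at_withinI)
  then show "(f has_derivative frechet_derivative g (at p)) (at p within S)"
  proof (rule has_derivative_transform_eventually)
    show "\<forall>\<^sub>F x in at p within S. g x = f x"
      using eventually_at_topological assms by blast
  qed (use assms tangent_space_in in auto)
qed

lemma dmap_add: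
  assumes "smooth_map S f" "smooth_map S g" "v \<in> tangent_space S p"
  shows "dmap S (\<lambda>x. f x + g x) p v = dmap S f p v + dmap S g p v"
  using assms tangent_space_in
  by (intro dmap_eq[where F = "\<lambda>v. dmap S f p v + dmap S g p v"]
      has_derivative_add smooth_map_has_dmap) auto

lemma dmap_bilinear:
  assumes "bounded_bilinear b" "smooth_map S f" "smooth_map S g" "v \<in> tangent_space S p"
  shows "dmap S (\<lambda>x. b (f x) (g x)) p v = b (f p) (dmap S g p v) + b (dmap S f p v) (g p)"
  using assms tangent_space_in
  by (intro dmap_eq[where F = "\<lambda>v. b (f p) (dmap S g p v) + b (dmap S f p v) (g p)"]
      bounded_bilinear.FDERIV[OF assms(1)] smooth_map_has_dmap) auto

lemma dmap_linear_compose: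
  assumes "bounded_linear h" "smooth_map S f" "v \<in> tangent_space S p"
  shows "dmap S (\<lambda>x. h (f x)) p v = h (dmap S f p v)"
  using assms tangent_space_in
  by (intro dmap_eq[where F = "\<lambda>v. h (dmap S f p v)"]
      bounded_linear.has_derivative[OF assms(1)] smooth_map_has_dmap) auto

lemma dmap_linear:
  assumes "bounded_linear h" "v \<in> tangent_space S p"
  shows "dmap S h p v = h v"
  by (rule dmap_eq[OF assms(2) bounded_linear_imp_has_derivative[OF assms(1)]])

lemma dmap_const: "v \<in> tangent_space S p \<Longrightarrow> dmap S (\<lambda>x. c) p v = 0"
  by (erule dmap_eq) (rule has_derivative_const)

section \<open>Smooth families of linear maps and iterated derivatives along vector fields\<close>

lemma smooth_map_linear_family:
  assumes "\<And>x. x \<in> S \<Longrightarrow> linear (L x)" "\<And>w. smooth_map S (\<lambda>x. L x w)" "smooth_map S W"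
  shows "smooth_map S (\<lambda>x. L x (W x))"
proof -
  have "smooth_map S (\<lambda>x. \<Sum>b\<in>Basis. (W x \<bullet> b) *\<^sub>R L x b)"
    by (intro assms smooth_map_sum smooth_map_bilinear[OF bounded_bilinear_scaleR]
        smooth_map_linear_compose[OF bounded_linear_inner_left])
  moreover have "(\<Sum>b\<in>Basis. (W x \<bullet> b) *\<^sub>R L x b) = L x (W x)" if "x \<in> S" for x
    using linear_basis_expansion[OF assms(1)[OF that], of "W x"] by simp
  ultimately show ?thesis
    using smooth_map_cong[of S "\<lambda>x. \<Sum>b\<in>Basis. (W x \<bullet> b) *\<^sub>R L x b" "\<lambda>x. L x (W x)"]
    by simp
qed

text \<open>The product rule for evaluation: the last term differentiates the family with its
  argument frozen at \<open>W p\<close>. It serves both for projections and for derivatives of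
  functions.\<close>

lemma dmap_linear_family:
  assumes lin: "\<And>x. x \<in> S \<Longrightarrow> linear (L x)" and L: "\<And>w. smooth_map S (\<lambda>x. L x w)"
    and W: "smooth_map S W" and v: "v \<in> tangent_space S p"
  shows "dmap S (\<lambda>x. L x (W x)) p v = L p (dmap S W p v) + dmap S (\<lambda>x. L x (W p)) p v"
proof -
  have p: "p \<in> S"
    using v by (rule tangent_space_in)
  have D: "dmap S (\<lambda>x. L x (V x)) p v =
      (\<Sum>b\<in>Basis. (V p \<bullet> b) *\<^sub>R dmap S (\<lambda>x. L x b) p v + (dmap S V p v \<bullet> b) *\<^sub>R L p b)"
    if "smooth_map S V" for V
  proof -
    have "dmap S (\<lambda>x. L x (V x)) p = dmap S (\<lambda>x. \<Sum>b\<in>Basis. (V x \<bullet> b) *\<^sub>R L x b) p"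
      using linear_basis_expansion[OF lin] by (intro dmap_cong p)
    moreover have "((\<lambda>x. \<Sum>b\<in>Basis. (V x \<bullet> b) *\<^sub>R L x b) has_derivative
      (\<lambda>v. \<Sum>b\<in>Basis. (V p \<bullet> b) *\<^sub>R dmap S (\<lambda>x. L x b) p v + (dmap S V p v \<bullet> b) *\<^sub>R L p b))
        (at p within S)"
      by (intro has_derivative_sum has_derivative_scaleR has_derivative_inner_left
          smooth_map_has_dmap that L p)
    ultimately show ?thesis
      using dmap_eq[OF v] by simp
  qed
  have "L p (dmap S W p v) = (\<Sum>b\<in>Basis. (dmap S W p v \<bullet> b) *\<^sub>R L p b)"
    by (rule linear_basis_expansion[OF lin[OF p]])
  then show ?thesis
    using D[OF W] D[OF smooth_map_const[of S "W p"]]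
    by (simp add: sum.distrib add.commute dmap_const[OF v])
qed

lemma smooth_on_imp_smooth_map: "open U \<Longrightarrow> smooth_on U f \<Longrightarrow> smooth_map U f"
  unfolding smooth_map_def by blast

text \<open>Makes an open set an instance of \<open>S\<close>, so that the rules for
  \<open>dmap\<close> also yield rules for ordinary derivatives.\<close>

lemma tangent_space_open:
  fixes U :: "'a::euclidean_space set"
  assumes "open U" "p \<in> U"
  shows "v \<in> tangent_space U p"
proof -
  let ?\<gamma> = "\<lambda>t::real. p + t *\<^sub>R v"
  have "open (?\<gamma> -` U)"
    using assms(1) by (intro open_vimage) (auto intro!: continuous_intros)
  moreover have "0 \<in> ?\<gamma> -` U"
    using assms(2) by simp
  ultimately obtain e where "e > 0" "ball 0 e \<subseteq> ?\<gamma> -` U"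
    by (rule openE)
  then have "\<And>t. t \<in> {-e<..<e} \<Longrightarrow> ?\<gamma> t \<in> U"
    by (auto simp: subset_iff dist_real_def)
  moreover have "smooth_on {-e<..<e} ?\<gamma>"
    by (intro smooth_on_add smooth_on_const smooth_on_linear bounded_linear_scaleR_left) simp
  moreover have "(?\<gamma> has_vector_derivative v) (at 0)"
    by (auto intro!: derivative_eq_intros simp: has_vector_derivative_def)
  ultimately show ?thesis
    unfolding tangent_space_def using \<open>e > 0\<close> by (intro CollectI exI[of _ ?\<gamma>] exI[of _ e]) simp
qed

lemma dmap_open: "open U \<Longrightarrow> p \<in> U \<Longrightarrow> dmap U f p = frechet_derivative f (at p)"
  using at_within_open[of p U] by (simp add: dmap_def[abs_def])

lemma frechet_derivative_apply:
  assumes U: "open U" "p \<in> U" and f: "smooth_on U f" and W: "smooth_on U W"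
  shows "frechet_derivative (\<lambda>x. frechet_derivative f (at x) (W x)) (at p) v =
    frechet_derivative f (at p) (frechet_derivative W (at p) v) +
    frechet_derivative (\<lambda>x. frechet_derivative f (at x) (W p)) (at p) v"
proof -
  have "linear (frechet_derivative f (at x))" if "x \<in> U" for x
    using smooth_onD(1)[OF f that] by (rule has_derivative_linear)
  then show ?thesis
    using dmap_linear_family[of U "\<lambda>x. frechet_derivative f (at x)" W v p,
        OF _ smooth_on_imp_smooth_map[OF U(1) smooth_onD(2)[OF f]]
          smooth_on_imp_smooth_map[OF U(1) W] tangent_space_open[OF U]]
    by (simp add: dmap_open[OF U])
qed

text \<open>Near \<open>p\<close>, the derivative of an extension of \<open>f\<close> in the
  direction of an extension of \<open>Y\<close> is a smooth extension: on tangent vectors it agrees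
  with \<open>dmap\<close>.\<close>

lemma smooth_map_dmap_apply:
  assumes "smooth_map S f" "vector_field S Y"
  shows "smooth_map S (\<lambda>x. dmap S f x (Y x))"
proof (rule smooth_mapI)
  fix p assume p: "p \<in> S"
  have Y: "smooth_map S Y" "\<And>x. x \<in> S \<Longrightarrow> Y x \<in> tangent_space S x"
    using assms(2) by (auto simp: vector_field_def)
  obtain U f' where U: "open U" "p \<in> U" "smooth_on U f'" "\<And>x. x \<in> S \<Longrightarrow> x \<in> U \<Longrightarrow> f' x = f x"
    using smooth_mapE[OF assms(1) p] by blast
  obtain V Y' where V: "open V" "p \<in> V" "smooth_on V Y'" "\<And>x. x \<in> S \<Longrightarrow> x \<in> V \<Longrightarrow> Y' x = Y x"
    using smooth_mapE[OF Y(1) p] by blast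
  have "smooth_on (U \<inter> V) (\<lambda>x. frechet_derivative f' (at x) (Y' x))"
    using U V
    by (intro smooth_on_frechet_derivative_apply smooth_on_subset[OF U(3)] smooth_on_subset[OF V(3)]) auto
  moreover have "frechet_derivative f' (at x) (Y' x) = dmap S f x (Y x)" if "x \<in> S \<inter> (U \<inter> V)" for x
    using that U V Y by (subst dmap_extension[where U=U and g=f']) auto
  ultimately show "\<exists>U h. open U \<and> p \<in> U \<and> smooth_on U h \<and> (\<forall>x\<in>S \<inter> U. h x = dmap S f x (Y x))"
    using U V by (intro exI[of _ "U \<inter> V"] exI) auto
qed


text \<open>For local extensions, each iterated derivative is a first derivative of \<open>f\<close>
  plus its second derivative at the two vectors; the latter terms cancel by symmetry. The tangency
  in \<open>Z\<close> is what lets the remaining first derivative be read as a \<open>dmap\<close>.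
  Since \<open>f\<close> may be vector-valued, the lemma covers both the bracket on functions and,
  with \<open>f\<close> a vector field, the curvature.\<close>

lemma dmap_commute:
  assumes f: "smooth_map S f" and X: "vector_field S X" and Y: "vector_field S Y" and p: "p \<in> S"
    and Z: "dmap S Y p (X p) - dmap S X p (Y p) \<in> tangent_space S p"
  shows "dmap S (\<lambda>x. dmap S f x (Y x)) p (X p) - dmap S (\<lambda>x. dmap S f x (X x)) p (Y p)
    = dmap S f p (dmap S Y p (X p) - dmap S X p (Y p))"
proof -
  have X': "smooth_map S X" "\<And>x. x \<in> S \<Longrightarrow> X x \<in> tangent_space S x"
    and Y': "smooth_map S Y" "\<And>x. x \<in> S \<Longrightarrow> Y x \<in> tangent_space S x"
    using X Y by (auto simp: vector_field_def)
  obtain U1 F where U1: "open U1" "p \<in> U1" "smooth_on U1 F" "\<And>x. x \<in> S \<Longrightarrow> x \<in> U1 \<Longrightarrow> F x = f x"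
    using smooth_mapE[OF f p] by blast
  obtain U2 A where U2: "open U2" "p \<in> U2" "smooth_on U2 A" "\<And>x. x \<in> S \<Longrightarrow> x \<in> U2 \<Longrightarrow> A x = X x"
    using smooth_mapE[OF X'(1) p] by blast
  obtain U3 B where U3: "open U3" "p \<in> U3" "smooth_on U3 B" "\<And>x. x \<in> S \<Longrightarrow> x \<in> U3 \<Longrightarrow> B x = Y x"
    using smooth_mapE[OF Y'(1) p] by blast
  define U where "U = U1 \<inter> U2 \<inter> U3"
  have U: "open U" "p \<in> U" and sub: "U \<subseteq> U1" "U \<subseteq> U2" "U \<subseteq> U3"
    and sm: "smooth_on U F" "smooth_on U A" "smooth_on U B"
    using U1 U2 U3 by (auto simp: U_def intro: smooth_on_subset[OF U1(3)] smooth_on_subset[OF U2(3)]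
        smooth_on_subset[OF U3(3)])
  let ?D = "\<lambda>g. frechet_derivative g (at p)"
  have first: "dmap S f x v = frechet_derivative F (at x) v"
    if "x \<in> U" "v \<in> tangent_space S x" for x v
    using dmap_extension[of U1 F x S f v] U1 sub that by blast
  have eq: "dmap S (\<lambda>x. dmap S f x (W x)) p v = ?D F (?D C v) + ?D (\<lambda>x. frechet_derivative F (at x) (C p)) v"
    if "\<And>x. x \<in> S \<Longrightarrow> W x \<in> tangent_space S x" "smooth_on U C"
      "\<And>x. x \<in> S \<Longrightarrow> x \<in> U \<Longrightarrow> C x = W x" "v \<in> tangent_space S p" for W C v
  proof -
    have "dmap S (\<lambda>x. dmap S f x (W x)) p v = ?D (\<lambda>x. frechet_derivative F (at x) (C x)) v"
    proof (rule dmap_extension[OF U(1) _ U(2) _ that(4)])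
      show "smooth_on U (\<lambda>x. frechet_derivative F (at x) (C x))"
        by (intro smooth_on_frechet_derivative_apply U sm that)
      show "frechet_derivative F (at x) (C x) = dmap S f x (W x)" if "x \<in> S" "x \<in> U" for x
        using first that \<open>\<And>x. x \<in> S \<Longrightarrow> W x \<in> tangent_space S x\<close>
          \<open>\<And>x. x \<in> S \<Longrightarrow> x \<in> U \<Longrightarrow> C x = W x\<close> by simp
    qed
    then show ?thesis
      using frechet_derivative_apply[OF U sm(1) that(2)] by simp
  qed
  have XY: "?D A (Y p) = dmap S X p (Y p)" "?D B (X p) = dmap S Y p (X p)"
    using dmap_extension[of U A p S X "Y p"] dmap_extension[of U B p S Y "X p"] U sm sub U2 U3 X' Y' p
    by (auto simp: subset_iff)
  have "linear (?D F)"
    using smooth_onD(1)[OF sm(1) U(2)] by (rule has_derivative_linear)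
  moreover have "A p = X p" "B p = Y p"
    using U2 U3 p by auto
  ultimately show ?thesis
    using eq[of Y B "X p"] eq[of X A "Y p"] X' Y' sm sub U2(4) U3(4) p first[OF U(2) Z]
      symmetric_second_derivative[OF U sm(1), of "X p" "Y p"] XY
    by (simp add: linear_diff subset_iff)
qed

subsection \<open>The Gauss equation\<close>

lemma vector_fieldD:
  assumes "vector_field S X"
  shows "smooth_map S X" "p \<in> S \<Longrightarrow> X p \<in> tangent_space S p"
  using assms by (auto simp: vector_field_def)

text \<open>\<open>Pi x\<close> is the orthogonal projection onto the tangent space. The last
  assumption is the symmetry of the second fundamental form, usually derived from charts; here it is
  what makes brackets of tangent fields tangent.\<close>

locale projected_submanifold =
  fixes S :: "'a::euclidean_space set" and Pi :: "'a \<Rightarrow> 'a \<Rightarrow> 'a"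
  assumes Pi_smooth: "smooth_map S (\<lambda>x. Pi x w)"
    and Pi_linear: "x \<in> S \<Longrightarrow> linear (Pi x)"
    and Pi_tangent: "x \<in> S \<Longrightarrow> Pi x w \<in> tangent_space S x"
    and Pi_ident: "v \<in> tangent_space S x \<Longrightarrow> Pi x v = v"
    and Pi_adjoint: "x \<in> S \<Longrightarrow> Pi x v \<bullet> w = v \<bullet> Pi x w"
    and Pi_derivative_symmetric: "v \<in> tangent_space S x \<Longrightarrow> w \<in> tangent_space S x \<Longrightarrow>
      dmap S (\<lambda>y. Pi y w) x v = dmap S (\<lambda>y. Pi y v) x w"
begin

text \<open>This is the second fundamental form only for tangent \<open>v\<close> and \<open>w\<close>.\<close>

definition II :: "'a \<Rightarrow> 'a \<Rightarrow> 'a \<Rightarrow> 'a" where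
  "II p v w = dmap S (\<lambda>x. Pi x w) p v"

definition proj_connection :: "('a \<Rightarrow> 'a) \<Rightarrow> ('a \<Rightarrow> 'a) \<Rightarrow> 'a \<Rightarrow> 'a" where
  "proj_connection X Y p = Pi p (dmap S Y p (X p))"

lemma tangent_iff: "x \<in> S \<Longrightarrow> v \<in> tangent_space S x \<longleftrightarrow> Pi x v = v"
  using Pi_ident Pi_tangent by metis

lemma tangent_diff:
  "v \<in> tangent_space S x \<Longrightarrow> w \<in> tangent_space S x \<Longrightarrow> v - w \<in> tangent_space S x"
  using tangent_iff[OF tangent_space_in] linear_diff[OF Pi_linear[OF tangent_space_in]] by metis

lemma vector_field_diff:
  "vector_field S X \<Longrightarrow> vector_field S Y \<Longrightarrow> vector_field S (\<lambda>x. X x - Y x)"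
  by (simp add: vector_field_def smooth_map_diff tangent_diff)

lemma smooth_map_Pi: "smooth_map S W \<Longrightarrow> smooth_map S (\<lambda>x. Pi x (W x))"
  by (rule smooth_map_linear_family[OF Pi_linear Pi_smooth])

lemma vector_field_Pi: "smooth_map S W \<Longrightarrow> vector_field S (\<lambda>x. Pi x (W x))"
  by (simp add: vector_field_def smooth_map_Pi Pi_tangent)

lemma dmap_Pi:
  assumes "smooth_map S W" "v \<in> tangent_space S p"
  shows "dmap S (\<lambda>x. Pi x (W x)) p v = Pi p (dmap S W p v) + II p v (W p)"
  unfolding II_def by (rule dmap_linear_family[OF Pi_linear Pi_smooth assms])

text \<open>Differentiate the identity \<open>Pi x (Y x) = Y x\<close>. The normal part of the
  derivative depends on \<open>Y\<close> only through \<open>Y p\<close>.\<close>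

lemma gauss_formula:
  assumes "vector_field S Y" "v \<in> tangent_space S p"
  shows "dmap S Y p v = Pi p (dmap S Y p v) + II p v (Y p)"
proof -
  have "dmap S Y p = dmap S (\<lambda>x. Pi x (Y x)) p"
    using Pi_ident[OF vector_fieldD(2)[OF assms(1)]]
    by (intro dmap_cong tangent_space_in[OF assms(2)]) simp
  then show ?thesis
    using dmap_Pi[OF vector_fieldD(1)[OF assms(1)] assms(2)] by simp
qed

text \<open>Apply the Gauss formula to the field \<open>\<lambda>x. Pi x w\<close>, which extends
  \<open>w\<close>: its derivative is \<open>II p v w\<close>, and so is the normal term, so the
  tangential term must vanish.\<close>

lemma Pi_II:
  assumes "v \<in> tangent_space S p" "w \<in> tangent_space S p"
  shows "Pi p (II p v w) = 0"
  using gauss_formula[OF vector_field_Pi[OF smooth_map_const[of S w]] assms(1)]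
    Pi_ident[OF assms(2)] by (simp add: II_def)

text \<open>The derivative of the self-adjointness of \<open>Pi\<close>. Here \<open>w\<close> and
  \<open>z\<close> range over the whole ambient space, so that an ambient derivative of a field may
  be inserted later.\<close>

lemma II_adjoint:
  assumes "v \<in> tangent_space S p"
  shows "II p v w \<bullet> z = w \<bullet> II p v z"
proof -
  have p: "p \<in> S"
    using assms by (rule tangent_space_in)
  have "dmap S (\<lambda>x. Pi x w \<bullet> z) p v = II p v w \<bullet> z"
    unfolding II_def by (rule dmap_linear_compose[OF bounded_linear_inner_left Pi_smooth assms])
  moreover have "dmap S (\<lambda>x. w \<bullet> Pi x z) p v = w \<bullet> II p v z"
    unfolding II_def by (rule dmap_linear_compose[OF bounded_linear_inner_right Pi_smooth assms])
  moreover have "dmap S (\<lambda>x. Pi x w \<bullet> z) p = dmap S (\<lambda>x. w \<bullet> Pi x z) p"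
    using Pi_adjoint by (intro dmap_cong p) simp
  ultimately show ?thesis
    by simp
qed

section \<open>Lie brackets and the projected connection\<close>

lemma bracket_tangent:
  assumes "vector_field S X" "vector_field S Y" "p \<in> S"
  shows "dmap S Y p (X p) - dmap S X p (Y p) =
      proj_connection X Y p - proj_connection Y X p"
    and "dmap S Y p (X p) - dmap S X p (Y p) \<in> tangent_space S p"
proof -
  have II: "II p (X p) (Y p) = II p (Y p) (X p)"
    unfolding II_def using assms by (intro Pi_derivative_symmetric vector_fieldD)
  have "dmap S Y p (X p) - dmap S X p (Y p) =
      (proj_connection X Y p + II p (X p) (Y p)) - (proj_connection Y X p + II p (Y p) (X p))"
    unfolding proj_connection_def using assms
    by (intro arg_cong2[where f = minus] gauss_formula vector_fieldD)
  with II show *: "dmap S Y p (X p) - dmap S X p (Y p) =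
      proj_connection X Y p - proj_connection Y X p"
    by simp
  show "dmap S Y p (X p) - dmap S X p (Y p) \<in> tangent_space S p"
    unfolding * proj_connection_def using assms by (intro tangent_diff Pi_tangent)
qed

lemma is_lie_bracket_dmap:
  assumes "vector_field S X" "vector_field S Y"
  shows "is_lie_bracket S X Y (\<lambda>p. dmap S Y p (X p) - dmap S X p (Y p))"
  unfolding is_lie_bracket_def derivation_def
proof (intro conjI allI impI ballI)
  show "vector_field S (\<lambda>p. dmap S Y p (X p) - dmap S X p (Y p))"
    using bracket_tangent(2)[OF assms] assms
    by (simp add: vector_field_def smooth_map_diff smooth_map_dmap_apply)
  show "dmap S f p (dmap S Y p (X p) - dmap S X p (Y p)) =
      dmap S (\<lambda>p. dmap S f p (Y p)) p (X p) - dmap S (\<lambda>p. dmap S f p (X p)) p (Y p)"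
    if "smooth_map S f" "p \<in> S" for f :: "'a \<Rightarrow> real" and p
    using dmap_commute[OF that(1) assms that(2) bracket_tangent(2)[OF assms that(2)]] by simp
qed

text \<open>The coordinate functions are smooth test functions, and the derivation of a field on
  them returns its components.\<close>

lemma lie_bracket_unique:
  assumes "is_lie_bracket S X Y Z" "vector_field S X" "vector_field S Y" "p \<in> S"
  shows "Z p = dmap S Y p (X p) - dmap S X p (Y p)"
proof (rule euclidean_eqI)
  fix b :: 'a
  let ?f = "\<lambda>x::'a. x \<bullet> b"
  have f: "bounded_linear ?f"
    by (rule bounded_linear_inner_left)
  have D: "derivation S W ?f x = W x \<bullet> b" if "vector_field S W" "x \<in> S" for W x
    unfolding derivation_def by (rule dmap_linear[OF f vector_fieldD(2)[OF that]])
  have D2: "derivation S V (derivation S W ?f) p = dmap S W p (V p) \<bullet> b"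
    if "vector_field S V" "vector_field S W" for V W
  proof -
    have "derivation S V (derivation S W ?f) p = dmap S (\<lambda>x. W x \<bullet> b) p (V p)"
      using dmap_cong[OF assms(4), of "derivation S W ?f" "\<lambda>x. W x \<bullet> b"] D[OF that(2)]
      unfolding derivation_def[of S V] by simp
    also have "\<dots> = dmap S W p (V p) \<bullet> b"
      by (rule dmap_linear_compose[OF f vector_fieldD(1)[OF that(2)]
            vector_fieldD(2)[OF that(1) assms(4)]])
    finally show ?thesis .
  qed
  have Z: "vector_field S Z" and
    "derivation S Z ?f p = derivation S X (derivation S Y ?f) p - derivation S Y (derivation S X ?f) p"
    using assms(1,4) smooth_map_linear[OF f, of S] unfolding is_lie_bracket_def by simp_all
  then show "Z p \<bullet> b = (dmap S Y p (X p) - dmap S X p (Y p)) \<bullet> b"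
    using D[OF Z assms(4)] D2[OF assms(2,3)] D2[OF assms(3,2)] by (simp add: inner_diff_left)
qed

lemma lie_bracket:
  assumes "vector_field S X" "vector_field S Y"
  shows vector_field_lie_bracket: "vector_field S (lie_bracket S X Y)"
    and lie_bracket_eq: "p \<in> S \<Longrightarrow> lie_bracket S X Y p = dmap S Y p (X p) - dmap S X p (Y p)"
proof -
  have *: "is_lie_bracket S X Y (lie_bracket S X Y)"
    unfolding lie_bracket_def
    by (rule someI[where P = "is_lie_bracket S X Y", OF is_lie_bracket_dmap[OF assms]])
  then show "vector_field S (lie_bracket S X Y)"
    by (simp add: is_lie_bracket_def)
  show "p \<in> S \<Longrightarrow> lie_bracket S X Y p = dmap S Y p (X p) - dmap S X p (Y p)"
    by (rule lie_bracket_unique[OF * assms])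
qed

lemma vector_field_proj_connection:
  "vector_field S X \<Longrightarrow> vector_field S Y \<Longrightarrow> vector_field S (proj_connection X Y)"
  unfolding proj_connection_def[abs_def]
  by (intro vector_field_Pi smooth_map_dmap_apply vector_fieldD)

lemma affine_connection_proj: "affine_connection S proj_connection"
  unfolding affine_connection_def
proof (intro conjI allI impI ballI)
  fix X Y assume "vector_field S X" "vector_field S Y"
  then show "vector_field S (proj_connection X Y)"
    by (rule vector_field_proj_connection)
next
  fix X X' Y p assume "vector_field S X" "vector_field S X'" "vector_field S Y" "p \<in> S"
  then show "proj_connection (\<lambda>x. X x + X' x) Y p = proj_connection X Y p + proj_connection X' Y p"
    by (simp add: proj_connection_def linear_add[OF linear_dmap] linear_add[OF Pi_linear] vector_fieldD)
next
  fix f :: "'a \<Rightarrow> real" and X Y p assume "smooth_map S f" "vector_field S X" "vector_field S Y" "p \<in> S"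
  then show "proj_connection (\<lambda>x. f x *\<^sub>R X x) Y p = f p *\<^sub>R proj_connection X Y p"
    by (simp add: proj_connection_def linear_cmul[OF linear_dmap] linear_cmul[OF Pi_linear] vector_fieldD)
next
  fix X Y Y' p assume "vector_field S X" "vector_field S Y" "vector_field S Y'" "p \<in> S"
  then show "proj_connection X (\<lambda>x. Y x + Y' x) p = proj_connection X Y p + proj_connection X Y' p"
    by (simp add: proj_connection_def dmap_add linear_add[OF Pi_linear] vector_fieldD)
next
  fix f :: "'a \<Rightarrow> real" and X Y p
  assume f: "smooth_map S f" and X: "vector_field S X" and Y: "vector_field S Y" and p: "p \<in> S"
  show "proj_connection X (\<lambda>x. f x *\<^sub>R Y x) p =
      derivation S X f p *\<^sub>R Y p + f p *\<^sub>R proj_connection X Y p"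
    using dmap_bilinear[OF bounded_bilinear_scaleR f vector_fieldD(1)[OF Y] vector_fieldD(2)[OF X p]]
      Pi_ident[OF vector_fieldD(2)[OF Y p]] p
    by (simp add: proj_connection_def derivation_def linear_add[OF Pi_linear]
        linear_cmul[OF Pi_linear])
qed

end

section \<open>Levi-Civita connection and curvature of a multiple of the induced metric\<close>

locale induced_metric = projected_submanifold +
  fixes g :: "'a \<Rightarrow> 'a \<Rightarrow> 'a \<Rightarrow> real" and c :: real
  assumes c_pos: "0 < c"
    and metric: "v \<in> tangent_space S p \<Longrightarrow> w \<in> tangent_space S p \<Longrightarrow> g p v w = c * (v \<bullet> w)"
begin

lemma is_levi_civita_proj: "is_levi_civita S g proj_connection"
  unfolding is_levi_civita_def
proof (intro conjI allI impI ballI)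
  show "affine_connection S proj_connection"
    by (rule affine_connection_proj)
next
  fix X Y p assume "vector_field S X" "vector_field S Y" "p \<in> S"
  then show "proj_connection X Y p - proj_connection Y X p = lie_bracket S X Y p"
    using bracket_tangent(1) lie_bracket_eq by simp
next
  fix X Y Z p
  assume X: "vector_field S X" and Y: "vector_field S Y" and Z: "vector_field S Z" and p: "p \<in> S"
  have "derivation S X (\<lambda>x. g x (Y x) (Z x)) p = dmap S (\<lambda>x. c * (Y x \<bullet> Z x)) p (X p)"
    unfolding derivation_def using vector_fieldD(2)[OF Y] vector_fieldD(2)[OF Z] metric
    by (subst dmap_cong[OF p, of _ "\<lambda>x. c * (Y x \<bullet> Z x)"]) auto
  also have "\<dots> = c * (dmap S (\<lambda>x. Y x \<bullet> Z x) p (X p))"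
    using X Y Z p
    by (intro dmap_linear_compose[OF bounded_linear_mult_right]
        smooth_map_bilinear[OF bounded_bilinear_inner] vector_fieldD)
  also have "dmap S (\<lambda>x. Y x \<bullet> Z x) p (X p) = Y p \<bullet> dmap S Z p (X p) + dmap S Y p (X p) \<bullet> Z p"
    using X Y Z p by (intro dmap_bilinear[OF bounded_bilinear_inner] vector_fieldD)
  \<comment> \<open>Pairing with a tangent vector hides the normal part of the derivative.\<close>
  also have "Y p \<bullet> dmap S Z p (X p) = Y p \<bullet> proj_connection X Z p"
    using Pi_adjoint[OF p, of "Y p"] Pi_ident[OF vector_fieldD(2)[OF Y p]]
    by (simp add: proj_connection_def)
  also have "dmap S Y p (X p) \<bullet> Z p = proj_connection X Y p \<bullet> Z p"
    using Pi_adjoint[OF p, of _ "Z p"] Pi_ident[OF vector_fieldD(2)[OF Z p]]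
    by (simp add: proj_connection_def)
  finally show "derivation S X (\<lambda>x. g x (Y x) (Z x)) p =
      g p (proj_connection X Y p) (Z p) + g p (Y p) (proj_connection X Z p)"
    using X Y Z p by (simp add: metric vector_fieldD vector_field_proj_connection algebra_simps)
qed

text \<open>
  The difference \<open>T\<close> of two Levi-Civita connections satisfies \<open>T X Y = T Y X\<close> and
  \<open>\<langle>T X Y, Z\<rangle> = - \<langle>Y, T X Z\<rangle>\<close>, which forces \<open>\<langle>T X Y, Z\<rangle> = 0\<close>.
\<close>

lemma levi_civita_unique:
  assumes N: "is_levi_civita S g N" and M: "is_levi_civita S g M"
    and X: "vector_field S X" and Y: "vector_field S Y" and p: "p \<in> S"
  shows "N X Y p = M X Y p"
proof -
  have vf: "vector_field S (N V W)" "vector_field S (M V W)"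
    if "vector_field S V" "vector_field S W" for V W
    using N M that unfolding is_levi_civita_def affine_connection_def by simp_all
  define T where "T V W = N V W p - M V W p" for V W
  have sym: "T V W = T W V" if "vector_field S V" "vector_field S W" for V W
  proof -
    have "N V W p - N W V p = lie_bracket S V W p" "M V W p - M W V p = lie_bracket S V W p"
      using N M that p unfolding is_levi_civita_def by simp_all
    then have "N V W p - N W V p = M V W p - M W V p"
      by simp
    then show ?thesis
      by (simp add: T_def algebra_simps)
  qed
  have skew: "T V W \<bullet> Z p = - (W p \<bullet> T V Z)"
    if V: "vector_field S V" and W: "vector_field S W" and Z: "vector_field S Z" for V W Z
  proof -
    have "g p (N V W p) (Z p) + g p (W p) (N V Z p) = g p (M V W p) (Z p) + g p (W p) (M V Z p)"
      using N M V W Z p unfolding is_levi_civita_def by (metis (no_types, lifting))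
    then have "c * (N V W p \<bullet> Z p + W p \<bullet> N V Z p) = c * (M V W p \<bullet> Z p + W p \<bullet> M V Z p)"
      using V W Z p by (simp add: metric vector_fieldD vf distrib_left)
    then have "N V W p \<bullet> Z p + W p \<bullet> N V Z p = M V W p \<bullet> Z p + W p \<bullet> M V Z p"
      using c_pos by simp
    then show ?thesis
      by (simp add: T_def inner_diff_left inner_diff_right)
  qed
  \<comment> \<open>The difference field itself is the test field: \<open>Z p = T X Y\<close>, so a
    vanishing inner product with it gives \<open>T X Y = 0\<close>.\<close>
  define Z where "Z x = N X Y x - M X Y x" for x
  have Z: "vector_field S Z"
    unfolding Z_def[abs_def] using X Y by (intro vector_field_diff vf)
  have "T X Y \<bullet> Z p = - (T X Y \<bullet> Z p)"
  proof -
    have "T X Y \<bullet> Z p = - (Y p \<bullet> T Z X)"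
      using skew[OF X Y Z] sym[OF X Z] by simp
    also have "\<dots> = X p \<bullet> T Y Z"
      using skew[OF Z X Y] sym[OF Z Y] by (simp add: inner_commute)
    also have "\<dots> = - (T X Y \<bullet> Z p)"
      using skew[OF Y Z X] sym[OF X Y] by (simp add: inner_commute)
    finally show ?thesis .
  qed
  then show ?thesis
    by (simp add: Z_def T_def)
qed

lemma levi_civita_eq:
  assumes "vector_field S X" "vector_field S Y"
  shows "vector_field S (levi_civita S g X Y)"
    and "p \<in> S \<Longrightarrow> levi_civita S g X Y p = Pi p (dmap S Y p (X p))"
proof -
  have *: "is_levi_civita S g (levi_civita S g)"
    unfolding levi_civita_def
    by (rule someI[where P = "is_levi_civita S g", OF is_levi_civita_proj])
  then show "vector_field S (levi_civita S g X Y)"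
    using assms unfolding is_levi_civita_def affine_connection_def by simp
  show "p \<in> S \<Longrightarrow> levi_civita S g X Y p = Pi p (dmap S Y p (X p))"
    using levi_civita_unique[OF * is_levi_civita_proj assms] by (simp add: proj_connection_def)
qed

text \<open>Pairing with \<open>X p\<close> removes the outer projections. The second derivatives of
  \<open>Y\<close> then cancel against the bracket term, and only products of second fundamental
  forms remain.\<close>

theorem gauss_equation:
  assumes X: "vector_field S X" and Y: "vector_field S Y" and p: "p \<in> S"
  shows "sectional_curvature S g X Y p =
    c * (II p (X p) (X p) \<bullet> II p (Y p) (Y p) - II p (X p) (Y p) \<bullet> II p (X p) (Y p))"
proof -
  let ?N = "levi_civita S g"
  note Xp = vector_fieldD(2)[OF X p] and Yp = vector_fieldD(2)[OF Y p]
  note lin = linear_diff[OF Pi_linear[OF p]] linear_diff[OF linear_dmap[OF vector_fieldD(1)[OF Y] p]]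
  have inner_Pi: "Pi p u \<bullet> X p = u \<bullet> X p" for u
    using Pi_adjoint[OF p] Pi_ident[OF Xp] by simp
  have iter: "?N V (?N W Y) p \<bullet> X p =
      dmap S (\<lambda>x. dmap S Y x (W x)) p (V p) \<bullet> X p + II p (W p) (Y p) \<bullet> II p (V p) (X p)"
    if V: "vector_field S V" and W: "vector_field S W" for V W
  proof -
    note Vp = vector_fieldD(2)[OF V p] and Wp = vector_fieldD(2)[OF W p]
    have "?N V (?N W Y) p \<bullet> X p = dmap S (?N W Y) p (V p) \<bullet> X p"
      using levi_civita_eq(2)[OF V levi_civita_eq(1)[OF W Y] p] inner_Pi by simp
    also have "dmap S (?N W Y) p = dmap S (\<lambda>x. Pi x (dmap S Y x (W x))) p"
      by (rule dmap_cong[OF p levi_civita_eq(2)[OF W Y]])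
    also have "dmap S (\<lambda>x. Pi x (dmap S Y x (W x))) p (V p) =
        Pi p (dmap S (\<lambda>x. dmap S Y x (W x)) p (V p)) + II p (V p) (dmap S Y p (W p))"
      by (rule dmap_Pi[OF smooth_map_dmap_apply[OF vector_fieldD(1)[OF Y] W] Vp])
    finally have "?N V (?N W Y) p \<bullet> X p = dmap S (\<lambda>x. dmap S Y x (W x)) p (V p) \<bullet> X p
        + dmap S Y p (W p) \<bullet> II p (V p) (X p)"
      using II_adjoint[OF Vp] inner_Pi by (simp add: inner_add_left)
    \<comment> \<open>Split off the tangential part of the derivative, which is orthogonal to the
      normal vector \<open>II p (V p) (X p)\<close>.\<close>
    also have "dmap S Y p (W p) \<bullet> II p (V p) (X p) =
        (Pi p (dmap S Y p (W p)) + II p (W p) (Y p)) \<bullet> II p (V p) (X p)"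
      using gauss_formula[OF Y Wp] by simp
    also have "\<dots> = II p (W p) (Y p) \<bullet> II p (V p) (X p)"
      using Pi_adjoint[OF p] Pi_II[OF Vp Xp] by (simp add: inner_add_left)
    finally show ?thesis .
  qed
  \<comment> \<open>\<open>dmap_commute\<close> with \<open>Y\<close> also as the differentiated
    map: the bracket term is exactly the difference of the two iterated derivatives.\<close>
  have bracket: "?N (lie_bracket S X Y) Y p \<bullet> X p =
      (dmap S (\<lambda>x. dmap S Y x (Y x)) p (X p) - dmap S (\<lambda>x. dmap S Y x (X x)) p (Y p)) \<bullet> X p"
    using levi_civita_eq(2)[OF vector_field_lie_bracket[OF X Y] Y p] inner_Pi
      lie_bracket_eq[OF X Y p]
      dmap_commute[OF vector_fieldD(1)[OF Y] X Y p bracket_tangent(2)[OF X Y p]] by simp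
  have "riemann_curvature S g X Y Y p \<in> tangent_space S p"
    unfolding riemann_curvature_def Let_def using X Y p
    by (intro tangent_diff vector_fieldD(2) levi_civita_eq(1) vector_field_lie_bracket)
  then have "sectional_curvature S g X Y p = c * (riemann_curvature S g X Y Y p \<bullet> X p)"
    by (simp add: sectional_curvature_def metric Xp)
  also have "riemann_curvature S g X Y Y p \<bullet> X p =
      II p (Y p) (Y p) \<bullet> II p (X p) (X p) - II p (X p) (Y p) \<bullet> II p (Y p) (X p)"
    using iter[OF X Y] iter[OF Y X] bracket
    by (simp add: riemann_curvature_def Let_def inner_diff_left)
  also have "II p (Y p) (X p) = II p (X p) (Y p)"
    unfolding II_def by (rule Pi_derivative_symmetric[OF Yp Xp])
  finally show ?thesis
    by (simp add: inner_commute)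
qed

end

subsection \<open>The tangent space of the special orthogonal group\<close>

lemma bounded_bilinear_matrix_mult:
  "bounded_bilinear ((**) :: real^'n^'m \<Rightarrow> real^'p^'n \<Rightarrow> real^'p^'m)"
  unfolding bilinear_conv_bounded_bilinear[symmetric] bilinear_def
  by (auto intro!: linearI simp: vec_eq_iff matrix_matrix_mult_def sum.distrib sum_distrib_left
      algebra_simps)

interpretation matmul: bounded_bilinear "(**) :: real^'n^'m \<Rightarrow> real^'p^'n \<Rightarrow> real^'p^'m"
  by (rule bounded_bilinear_matrix_mult)

lemmas matmul_simps = matmul.add_left matmul.add_right matmul.diff_left matmul.diff_right
  matmul.minus_left matmul.minus_right matmul.scaleR_left matmul.scaleR_right
  matmul.zero_left matmul.zero_right matrix_mul_assoc

lemma linear_transpose: "linear (transpose :: real^'n^'m \<Rightarrow> real^'m^'n)"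
  by (rule linearI) (simp_all add: vec_eq_iff transpose_def)

lemmas transpose_simps = linear_add[OF linear_transpose] linear_diff[OF linear_transpose]
  linear_neg[OF linear_transpose] linear_0[OF linear_transpose] linear_cmul[OF linear_transpose]
  linear_sum[OF linear_transpose] matrix_transpose_mul

lemma bounded_linear_transpose: "bounded_linear (transpose :: real^'n^'m \<Rightarrow> real^'m^'n)"
  using linear_transpose by (rule linear_conv_bounded_linear[THEN iffD1])

lemma inner_matrix_trace: "A \<bullet> B = trace (transpose A ** B)" for A B :: "real^'n^'m"
proof -
  have "A \<bullet> B = (\<Sum>i\<in>UNIV. \<Sum>j\<in>UNIV. A $ i $ j * B $ i $ j)"
    by (simp add: inner_vec_def)
  also have "\<dots> = (\<Sum>j\<in>UNIV. \<Sum>i\<in>UNIV. A $ i $ j * B $ i $ j)"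
    by (rule sum.swap)
  finally show ?thesis
    by (simp add: trace_def matrix_matrix_mult_def transpose_def)
qed

lemma skew_norm_power2: "(skew_norm A)\<^sup>2 = 1/2 * (A \<bullet> A)"
  by (simp add: skew_norm_def inner_matrix_trace[symmetric])

lemma inner_transpose: "transpose A \<bullet> B = A \<bullet> transpose B" for A :: "real^'n^'m"
  using sum.swap[of "\<lambda>i j. A $ j $ i * B $ i $ j" UNIV UNIV] by (simp add: inner_vec_def transpose_def)

lemma inner_mult_left: "(A ** B) \<bullet> C = B \<bullet> (transpose A ** C)"
  for A :: "real^'n^'m" and B :: "real^'p^'n"
  by (simp add: inner_matrix_trace matrix_transpose_mul matrix_mul_assoc)

lemma inner_mult_right: "(A ** B) \<bullet> C = A \<bullet> (C ** transpose B)"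
  for A :: "real^'n^'m" and B :: "real^'p^'n"
proof -
  have "(A ** B) \<bullet> C = transpose (A ** B) \<bullet> transpose C"
    by (simp add: inner_transpose)
  also have "\<dots> = transpose A \<bullet> transpose (C ** transpose B)"
    by (simp add: matrix_transpose_mul inner_mult_left)
  finally show ?thesis
    by (simp add: inner_transpose)
qed

lemma bounded_bilinear_commutator: "bounded_bilinear (commutator :: real^'n^'n \<Rightarrow> _)"
  unfolding bilinear_conv_bounded_bilinear[symmetric] bilinear_def commutator_def
  by (auto intro!: linearI simp: matmul_simps algebra_simps)

interpretation commutator: bounded_bilinear "commutator :: real^'n^'n \<Rightarrow> _"
  by (rule bounded_bilinear_commutator)

lemma commutator_jacobi:
  "commutator (commutator A B) C = commutator A (commutator B C) - commutator B (commutator A C)"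
  by (simp add: commutator_def matmul_simps)

lemma transpose_commutator: "transpose (commutator A B) = commutator (transpose B) (transpose A)"
  by (simp add: commutator_def transpose_simps)

lemma commutator_swap: "commutator A B = - commutator B A"
  by (simp add: commutator_def)

lemma inner_commutator_skew:
  assumes "transpose A = - A"
  shows "commutator A V \<bullet> W = - (V \<bullet> commutator A W)"
  by (simp add: commutator_def inner_diff_left inner_diff_right inner_mult_left[of A]
      inner_mult_right[of V] assms matmul_simps)

lemma inner_commutator_symmetric:
  assumes "transpose P = P"
  shows "commutator A P \<bullet> V = A \<bullet> commutator V P"
  by (simp add: commutator_def inner_diff_left inner_diff_right inner_mult_left[of P]
      inner_mult_right[of A] assms)

text \<open>
  Tangent vectors of \<open>SO(n)\<close> at the identity: products of the rotations
  \<open>1 + sin(t/2) E + (1 - cos(t/2)) E\<^sup>2\<close>, where \<open>E\<^sup>3 = - E\<close>, realise every skew matrix as a velocity.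
  Each rotation is used twice, so that the determinant is a square.
\<close>

definition SO_velocity :: "real^'n^'n \<Rightarrow> bool" where
  "SO_velocity A \<longleftrightarrow> (\<exists>\<gamma>. smooth_on UNIV \<gamma> \<and> (\<forall>t::real. \<gamma> t \<in> special_orthogonal) \<and>
     \<gamma> 0 = mat 1 \<and> (\<gamma> has_vector_derivative A) (at 0))"

lemma special_orthogonal_iff:
  "Q \<in> special_orthogonal \<longleftrightarrow> transpose Q ** Q = mat 1 \<and> Q ** transpose Q = mat 1 \<and> det Q = 1"
  by (simp add: special_orthogonal_def rotation_matrix_def orthogonal_matrix_def)

lemma special_orthogonal_mult:
  "P \<in> special_orthogonal \<Longrightarrow> Q \<in> special_orthogonal \<Longrightarrow> P ** Q \<in> special_orthogonal"
  by (simp add: special_orthogonal_def rotation_matrix_def orthogonal_matrix_mul det_mul)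

lemma has_vector_derivative_matrix_mult:
  fixes f :: "real \<Rightarrow> real^'n^'m" and g :: "real \<Rightarrow> real^'p^'n"
  assumes "(f has_vector_derivative f') (at t)" "(g has_vector_derivative g') (at t)"
  shows "((\<lambda>t. f t ** g t) has_vector_derivative f t ** g' + f' ** g t) (at t)"
  using assms by (rule bounded_bilinear.has_vector_derivative[OF bounded_bilinear_matrix_mult])

lemma SO_velocity_0: "SO_velocity 0"
  unfolding SO_velocity_def
  by (rule exI[of _ "\<lambda>t. mat 1"]) (simp add: smooth_on_const special_orthogonal_iff)

lemma SO_velocity_add:
  assumes "SO_velocity A" "SO_velocity B"
  shows "SO_velocity (A + B)"
proof -
  obtain f where f: "smooth_on UNIV f" "\<And>t::real. f t \<in> special_orthogonal" "f 0 = mat 1"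
    "(f has_vector_derivative A) (at 0)"
    using assms(1) unfolding SO_velocity_def by metis
  obtain g where g: "smooth_on UNIV g" "\<And>t::real. g t \<in> special_orthogonal" "g 0 = mat 1"
    "(g has_vector_derivative B) (at 0)"
    using assms(2) unfolding SO_velocity_def by metis
  have "((\<lambda>t. f t ** g t) has_vector_derivative A + B) (at 0)"
    using has_vector_derivative_matrix_mult[OF f(4) g(4)] f(3) g(3) by (simp add: add.commute)
  then show ?thesis
    unfolding SO_velocity_def using f g smooth_on_bilinear[OF _ bounded_bilinear_matrix_mult f(1) g(1)]
    by (intro exI[of _ "\<lambda>t. f t ** g t"]) (simp add: special_orthogonal_mult)
qed

lemma SO_velocity_sum:
  "finite I \<Longrightarrow> (\<And>i. i \<in> I \<Longrightarrow> SO_velocity (A i)) \<Longrightarrow> SO_velocity (\<Sum>i\<in>I. A i)"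
  by (induction I rule: finite_induct) (auto intro: SO_velocity_0 SO_velocity_add)

lemma SO_velocity_rotation:
  fixes E :: "real^'n^'n"
  assumes skew: "transpose E = - E" and cube: "E ** E ** E = - E"
  shows "SO_velocity (a *\<^sub>R E)"
proof -
  define R where "R t = mat 1 + sin (a / 2 * t) *\<^sub>R E + (1 - cos (a / 2 * t)) *\<^sub>R (E ** E)" for t :: real
  have orth: "transpose (R t) ** R t = mat 1" for t
  proof -
    \<comment> \<open>The terms in \<open>E\<close> cancel, and the cube relation turns the fourth
      power of \<open>E\<close> into \<open>- (E ** E)\<close>; this leaves one coefficient, which
      vanishes for s = sin x and u = 1 - cos x.\<close>
    have expand: "transpose (mat 1 + s *\<^sub>R E + u *\<^sub>R (E ** E)) ** (mat 1 + s *\<^sub>R E + u *\<^sub>R (E ** E)) =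
        mat 1 + (2 * u - s * s - u * u) *\<^sub>R (E ** E)" for s u
      by (simp add: transpose_simps skew matmul_simps cube) (simp add: vec_eq_iff algebra_simps)
    have "2 * (1 - cos x) - sin x * sin x - (1 - cos x) * (1 - cos x) = 0" for x :: real
      using sin_cos_squared_add3[of x] by (simp add: algebra_simps)
    then show ?thesis
      unfolding R_def expand by simp
  qed
  have sc: "smooth_on UNIV (\<lambda>t. sin (a / 2 * t))" "smooth_on UNIV (\<lambda>t. 1 - cos (a / 2 * t))"
  proof -
    show "smooth_on UNIV (\<lambda>t. sin (a / 2 * t))"
      using Ck_on_sin_cos[of UNIV _ 0 "a / 2" 1] by (simp add: smooth_on_def)
    have "smooth_on UNIV (\<lambda>t. 1 + - cos (a / 2 * t))"
      using Ck_on_sin_cos[of UNIV _ "-1" "a / 2" 0]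
      by (intro smooth_on_add smooth_on_const) (simp_all add: smooth_on_def)
    then show "smooth_on UNIV (\<lambda>t. 1 - cos (a / 2 * t))"
      by simp
  qed
  have R: "smooth_on UNIV R"
    unfolding R_def[abs_def]
    by (intro smooth_on_add smooth_on_const smooth_on_bilinear[OF _ bounded_bilinear_scaleR] sc) simp_all
  have "(R has_vector_derivative (a / 2) *\<^sub>R E) (at 0)"
    unfolding R_def[abs_def] has_vector_derivative_def
    by (auto intro!: derivative_eq_intros)
  then have "((\<lambda>t. R t ** R t) has_vector_derivative R 0 ** ((a / 2) *\<^sub>R E) + ((a / 2) *\<^sub>R E) ** R 0) (at 0)"
    by (intro has_vector_derivative_matrix_mult)
  moreover have R0: "R 0 = mat 1"
    by (simp add: R_def)
  ultimately have D: "((\<lambda>t. R t ** R t) has_vector_derivative a *\<^sub>R E) (at 0)"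
    by (simp flip: scaleR_add_left)
  have "R t ** R t \<in> special_orthogonal" for t
  proof -
    have "orthogonal_matrix (R t)"
      using orth by (simp add: orthogonal_matrix)
    moreover from this have "det (R t) = 1 \<or> det (R t) = -1"
      by (rule det_orthogonal_matrix)
    ultimately show ?thesis
      by (auto simp: special_orthogonal_def rotation_matrix_def orthogonal_matrix_mul det_mul)
  qed
  then show ?thesis
    unfolding SO_velocity_def using D R0 smooth_on_bilinear[OF _ bounded_bilinear_matrix_mult R R]
    by (intro exI[of _ "\<lambda>t. R t ** R t"]) simp
qed

definition matrix_unit :: "'n \<Rightarrow> 'n \<Rightarrow> real^'n^'n" where
  "matrix_unit k l = (\<chi> i j. if i = k \<and> j = l then 1 else 0)"

lemma matrix_unit_mult: "matrix_unit k l ** matrix_unit m n = (if l = m then matrix_unit k n else 0)"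
  by (auto simp: matrix_unit_def matrix_matrix_mult_def vec_eq_iff if_distrib[of "\<lambda>x. x * _"]
      if_distribR sum.delta cong: if_cong)

lemma transpose_matrix_unit: "transpose (matrix_unit k l) = matrix_unit l k"
  by (auto simp: matrix_unit_def transpose_def vec_eq_iff)

lemma matrix_unit_expansion: "A = (\<Sum>k\<in>UNIV. \<Sum>l\<in>UNIV. A $ k $ l *\<^sub>R matrix_unit k l)"
proof -
  have "(\<Sum>k\<in>UNIV. \<Sum>l\<in>UNIV. A $ k $ l *\<^sub>R matrix_unit k l) $ i $ j = A $ i $ j" for i j
  proof -
    have "(\<Sum>k\<in>UNIV. \<Sum>l\<in>UNIV. A $ k $ l *\<^sub>R matrix_unit k l) $ i $ j =
        (\<Sum>k\<in>UNIV. \<Sum>l\<in>UNIV. A $ k $ l * (if i = k \<and> j = l then 1 else 0))"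
      by (simp add: matrix_unit_def)
    also have "\<dots> = (\<Sum>k\<in>UNIV. if i = k then \<Sum>l\<in>UNIV. if j = l then A $ k $ l else 0 else 0)"
      by (rule sum.cong) (simp_all add: if_distrib[of "(*) _"] cong: if_cong)
    finally show ?thesis
      by simp
  qed
  then show ?thesis
    by (simp add: vec_eq_iff)
qed

text \<open>The differences \<open>matrix_unit k l - matrix_unit l k\<close> with distinct indices
  generate plane rotations and satisfy the cube relation. The coefficients are halved because every
  pair of indices occurs in both orders.\<close>

lemma SO_velocity_skew:
  assumes "transpose A = - A"
  shows "SO_velocity A"
proof -
  let ?E = "\<lambda>k l. matrix_unit k l - matrix_unit l k :: real^'n^'n"
  have "SO_velocity (a *\<^sub>R ?E k l)" for a k l
  proof (cases "k = l")
    case False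
    then show ?thesis
      by (intro SO_velocity_rotation)
         (simp_all add: transpose_simps transpose_matrix_unit matmul_simps matrix_unit_mult)
  qed (simp add: SO_velocity_0)
  then have "SO_velocity (\<Sum>k\<in>UNIV. \<Sum>l\<in>UNIV. (A $ k $ l / 2) *\<^sub>R ?E k l)"
    by (intro SO_velocity_sum) auto
  also have "(\<Sum>k\<in>UNIV. \<Sum>l\<in>UNIV. (A $ k $ l / 2) *\<^sub>R ?E k l) =
      (1/2) *\<^sub>R (\<Sum>k\<in>UNIV. \<Sum>l\<in>UNIV. A $ k $ l *\<^sub>R matrix_unit k l)
      - (1/2) *\<^sub>R transpose (\<Sum>k\<in>UNIV. \<Sum>l\<in>UNIV. A $ k $ l *\<^sub>R matrix_unit k l)"
    by (simp add: transpose_simps transpose_matrix_unit scaleR_sum_right scaleR_diff_right sum_subtractf)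
  also have "\<dots> = A"
    unfolding matrix_unit_expansion[of A, symmetric] assms
    by (simp flip: scaleR_add_left)
  finally show ?thesis .
qed

lemma dmap_constant_on:
  assumes "v \<in> tangent_space S p" "\<And>x. x \<in> S \<Longrightarrow> f x = c"
  shows "dmap S f p v = 0"
  using dmap_cong[OF tangent_space_in[OF assms(1)], of f "\<lambda>x. c"] assms(2) dmap_const[OF assms(1)]
  by simp

text \<open>One direction differentiates \<open>transpose Q ** Q = mat 1\<close>; the other
  left-translates a curve through the identity.\<close>

lemma tangent_space_special_orthogonal:
  assumes Q: "Q \<in> special_orthogonal"
  shows "v \<in> tangent_space special_orthogonal Q \<longleftrightarrow> transpose (transpose Q ** v) = - (transpose Q ** v)"
proof
  assume v: "v \<in> tangent_space special_orthogonal Q"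
  have "dmap special_orthogonal (\<lambda>Q. transpose Q ** Q) Q v = 0"
    by (rule dmap_constant_on[OF v]) (simp add: special_orthogonal_iff)
  moreover have "dmap special_orthogonal (\<lambda>Q. transpose Q ** Q) Q v =
      transpose Q ** dmap special_orthogonal (\<lambda>Q. Q) Q v + dmap special_orthogonal transpose Q v ** Q"
    by (intro dmap_bilinear[OF bounded_bilinear_matrix_mult] v
        smooth_map_linear bounded_linear_ident bounded_linear_transpose)
  ultimately have "transpose Q ** v + transpose v ** Q = 0"
    by (simp add: dmap_linear[OF bounded_linear_ident v] dmap_linear[OF bounded_linear_transpose v])
  then show "transpose (transpose Q ** v) = - (transpose Q ** v)"
    by (simp add: transpose_simps add_eq_0_iff)
next
  assume "transpose (transpose Q ** v) = - (transpose Q ** v)"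
  then obtain \<gamma> where \<gamma>: "smooth_on UNIV \<gamma>" "\<And>t::real. \<gamma> t \<in> special_orthogonal" "\<gamma> 0 = mat 1"
    "(\<gamma> has_vector_derivative transpose Q ** v) (at 0)"
    using SO_velocity_skew unfolding SO_velocity_def by metis
  have "smooth_on UNIV (\<lambda>t. Q ** \<gamma> t)"
    by (rule smooth_on_linear_compose[OF _ matmul.bounded_linear_right \<gamma>(1)]) simp
  moreover have "((\<lambda>t. Q ** \<gamma> t) has_vector_derivative v) (at 0)"
    using bounded_linear.has_vector_derivative[OF matmul.bounded_linear_right[of Q] \<gamma>(4)] Q
    by (simp add: matrix_mul_assoc special_orthogonal_iff)
  ultimately show "v \<in> tangent_space special_orthogonal Q"
    unfolding tangent_space_def using \<gamma> special_orthogonal_mult[OF Q]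
    by (intro CollectI exI[of _ "\<lambda>t. Q ** \<gamma> t"] exI[of _ 1]) (auto intro: smooth_on_subset[of UNIV])
qed

subsection \<open>Transitivity on flags\<close>

type_synonym 'n square_matrix = "((real, 'n) vec, 'n) vec"

type_synonym ('n, 'r) matrix_tuple = "('n square_matrix, 'r) vec"

text \<open>A complete system of mutually orthogonal projections. Compared with the equations of a
  flag it records that the sum is the identity; \<open>resolution_flag\<close> supplies
  this.\<close>

definition resolution :: "real^'n^'n^('r::finite) \<Rightarrow> bool" where
  "resolution P \<longleftrightarrow> (\<forall>i. transpose (P $ i) = P $ i) \<and>
     (\<forall>i j. P $ i ** P $ j = (if i = j then P $ i else 0)) \<and> (\<Sum>i\<in>UNIV. P $ i) = mat 1"

lemma resolutionD:
  assumes "resolution P"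
  shows "transpose (P $ i) = P $ i" "P $ i ** P $ i = P $ i" "i \<noteq> j \<Longrightarrow> P $ i ** P $ j = 0"
    and "(\<Sum>i\<in>UNIV. P $ i) = mat 1"
    and "X ** P $ i ** P $ i = X ** P $ i" "i \<noteq> j \<Longrightarrow> X ** P $ i ** P $ j = 0"
  using assms by (auto simp: resolution_def simp flip: matrix_mul_assoc)

section \<open>Block structure of the standard flag, and transitivity\<close>

definition position :: "'n::{finite,linorder} \<Rightarrow> nat" where
  "position k = card {m. m < k}"

lemma bij_betw_position: "bij_betw position (UNIV :: 'n::{finite,linorder} set) {..<CARD('n)}"
proof -
  have mono: "position k < position l" if "k < l" for k l :: 'n
    unfolding position_def using that by (intro psubset_card_mono) auto
  then have inj: "inj (position :: 'n \<Rightarrow> nat)"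
    by (intro injI) (metis less_irrefl neq_iff)
  moreover have "position ` (UNIV :: 'n set) \<subseteq> {..<CARD('n)}"
    unfolding position_def by (auto intro!: psubset_card_mono)
  ultimately have "position ` (UNIV :: 'n set) = {..<CARD('n)}"
    by (intro card_subset_eq) (simp_all add: card_image)
  with inj show ?thesis
    by (simp add: bij_betw_def)
qed

lemma sum_atMost_lessThan:
  "(\<Sum>j | j \<le> i. q j) = (\<Sum>j | j < i. q j) + q i" for q :: "'r::{finite,linorder} \<Rightarrow> nat"
proof -
  have "{j. j \<le> i} = insert i {j. j < i}"
    by auto
  then show ?thesis
    by simp
qed

context
  fixes q :: "'r::{finite,linorder} \<Rightarrow> nat"
  assumes sum_q: "(\<Sum>i\<in>UNIV. q i) = CARD('n::{finite,linorder})"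
begin

lemma card_block: "card (block q i :: 'n set) = q i"
proof -
  let ?I = "{(\<Sum>j | j < i. q j)..<(\<Sum>j | j \<le> i. q j)}"
  have "(\<Sum>j | j \<le> i. q j) \<le> CARD('n)"
    unfolding sum_q[symmetric] by (intro sum_mono2) auto
  then have sub: "?I \<subseteq> position ` (UNIV :: 'n set)"
    using bij_betw_position by (auto simp: bij_betw_def)
  have block: "(block q i :: 'n set) = position -` ?I"
    by (auto simp: block_def position_def)
  have "card (block q i :: 'n set) = card (position ` (block q i :: 'n set))"
    using bij_betw_position by (intro card_image[symmetric]) (auto simp: bij_betw_def inj_on_def)
  also have "position ` (block q i :: 'n set) = ?I"
    using sub unfolding block by auto
  finally show ?thesis
    by (simp add: sum_atMost_lessThan)
qed

lemma disjoint_blocks: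
  assumes "k \<in> block q i" "k \<in> block q j"
  shows "i = j"
proof -
  have "\<not> i < j" if "k \<in> block q i" "k \<in> block q j" for i j :: 'r
  proof
    assume "i < j"
    then have "(\<Sum>l | l \<le> i. q l) \<le> (\<Sum>l | l < j. q l)"
      by (intro sum_mono2) auto
    then show False
      using that by (auto simp: block_def)
  qed
  with assms show ?thesis
    by (metis neq_iff)
qed

text \<open>Disjoint blocks whose sizes add up to the number of indices exhaust them.\<close>

lemma block_cover: "\<exists>i. (k :: 'n) \<in> block q i"
proof -
  have "card (\<Union>i. block q i :: 'n set) = (\<Sum>i\<in>UNIV. card (block q i :: 'n set))"
    using disjoint_blocks by (intro card_UN_disjoint) (auto simp: disjoint_iff)
  also have "\<dots> = CARD('n)"
    by (simp add: card_block sum_q)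
  finally have "(\<Union>i. block q i :: 'n set) = UNIV"
    by (intro card_subset_eq) auto
  then show ?thesis
    by blast
qed

definition block_index :: "'n \<Rightarrow> 'r" where
  "block_index k = (THE i. k \<in> block q i)"

lemma block_iff: "(k :: 'n) \<in> block q i \<longleftrightarrow> i = block_index k"
  unfolding block_index_def using block_cover[of k] disjoint_blocks by (metis theI)

lemma resolution_standard_flag: "resolution (standard_flag q :: ('n, 'r) matrix_tuple)"
  unfolding resolution_def
proof (intro conjI allI)
  fix i j
  show "transpose ((standard_flag q :: ('n, 'r) matrix_tuple) $ i) = standard_flag q $ i"
    by (auto simp: standard_flag_def transpose_def vec_eq_iff)
  have "((standard_flag q :: ('n, 'r) matrix_tuple) $ i ** standard_flag q $ j) $ k $ l =
      (if i = j then (standard_flag q :: ('n, 'r) matrix_tuple) $ i else 0) $ k $ l" for k l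
  proof -
    have "((standard_flag q :: ('n, 'r) matrix_tuple) $ i ** standard_flag q $ j) $ k $ l =
        (\<Sum>m\<in>UNIV. if k = m then (if k \<in> block q i \<and> k = l \<and> k \<in> block q j then 1 else 0) else 0)"
      unfolding matrix_matrix_mult_def standard_flag_def vec_lambda_beta by (rule sum.cong) auto
    then show ?thesis
      by (auto simp: standard_flag_def block_iff)
  qed
  then show "(standard_flag q :: ('n, 'r) matrix_tuple) $ i ** standard_flag q $ j =
      (if i = j then standard_flag q $ i else 0)"
    by (simp add: vec_eq_iff)
next
  show "(\<Sum>i\<in>UNIV. (standard_flag q :: ('n, 'r) matrix_tuple) $ i) = mat 1"
    by (auto simp: vec_eq_iff standard_flag_def mat_def block_iff)
qed

text \<open>
  Orthonormal bases of the ranges of the \<open>P $ i\<close>, distributed over the blocks, are the columns of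
  an orthogonal matrix; reversing one column corrects the sign of the determinant.
\<close>

lemma flag_action_transitive:
  assumes "P \<in> flag_manifold q"
  obtains Q :: "'n square_matrix" where "Q \<in> special_orthogonal" "flag_action Q (standard_flag q) = P"
proof -
  have P: "P $ i ** P $ i = P $ i" "transpose (P $ i) = P $ i" "rank (P $ i) = q i"
    "i \<noteq> j \<Longrightarrow> P $ i ** P $ j = 0" for i j
    using assms by (auto simp: flag_manifold_def grassmannian_def)
  have "\<exists>u :: 'n \<Rightarrow> (real, 'n) vec. (\<forall>k\<in>block q i. P $ i *v u k = u k \<and> norm (u k) = 1) \<and>
      (\<forall>k\<in>block q i. \<forall>l\<in>block q i. k \<noteq> l \<longrightarrow> u k \<bullet> u l = 0)" for i
  proof -
    have "subspace (range ((*v) (P $ i)))"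
      by (intro linear_subspace_image matrix_vector_mul_linear subspace_UNIV)
    then obtain B where B: "B \<subseteq> range ((*v) (P $ i))" "pairwise orthogonal B"
      "\<And>x. x \<in> B \<Longrightarrow> norm x = 1" "independent B" "card B = dim (range ((*v) (P $ i)))"
      by (rule orthonormal_basis_subspace) auto
    have "card B = card (block q i :: 'n set)"
      using B(5) P(3)[of i] by (simp add: card_block rank_dim_range)
    moreover have "finite B"
      using B(4) by (rule independent_imp_finite)
    ultimately obtain u where u: "bij_betw u (block q i :: 'n set) B"
      using finite_same_card_bij[of "block q i :: 'n set" B] by auto
    have fixed: "P $ i *v x = x" if "x \<in> B" for x
      using B(1) that P(1)[of i] by (auto simp: matrix_vector_mul_assoc)
    have "u k \<bullet> u l = 0" if "k \<in> block q i" "l \<in> block q i" "k \<noteq> l" for k l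
      using pairwiseD[OF B(2), of "u k" "u l"] u that
      by (auto simp: bij_betw_def inj_on_def orthogonal_def)
    then show ?thesis
      using u B(3) fixed by (intro exI[of _ u]) (auto simp: bij_betw_def)
  qed
  then obtain u :: "'r \<Rightarrow> 'n \<Rightarrow> (real, 'n) vec" where u: 
    "\<And>i k. k \<in> block q i \<Longrightarrow> P $ i *v u i k = u i k"
    "\<And>i k. k \<in> block q i \<Longrightarrow> norm (u i k) = 1"
    "\<And>i k l. k \<in> block q i \<Longrightarrow> l \<in> block q i \<Longrightarrow> k \<noteq> l \<Longrightarrow> u i k \<bullet> u i l = 0"
    by metis
  define w where "w k = u (block_index k) k" for k
  have w_fix: "P $ i *v w k = (if k \<in> block q i then w k else 0)" for i k
  proof (cases "k \<in> block q i")
    case True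
    then show ?thesis
      using u(1)[of k i] by (simp add: w_def block_iff)
  next
    case False
    have "w k = P $ block_index k *v w k"
      using u(1)[of k "block_index k"] by (simp add: w_def block_iff)
    then have "P $ i *v w k = (P $ i ** P $ block_index k) *v w k"
      by (simp flip: matrix_vector_mul_assoc)
    then show ?thesis
      using False P(4)[of i "block_index k"] by (simp add: block_iff)
  qed
  have w_norm: "norm (w k) = 1" for k
    using u(2)[of k "block_index k"] by (simp add: w_def block_iff)
  have w_orth: "w k \<bullet> w l = 0" if "k \<noteq> l" for k l
  proof (cases "block_index k = block_index l")
    case True
    then show ?thesis
      using u(3)[of k "block_index k" l] that by (simp add: w_def block_iff)
  next
    case False
    \<comment> \<open>The projection belonging to the block of \<open>k\<close> is self-adjoint,
      fixes \<open>w k\<close> and kills \<open>w l\<close>.\<close>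
    have "w k \<bullet> w l = (P $ block_index k *v w k) \<bullet> w l"
      using w_fix[of "block_index k" k] by (simp add: block_iff)
    also have "\<dots> = w k \<bullet> (P $ block_index k *v w l)"
      using dot_lmul_matrix[of "w k" "P $ block_index k" "w l"] transpose_matrix_vector P(2)
      by metis
    also have "\<dots> = 0"
      using w_fix[of "block_index k" l] False by (simp add: block_iff)
    finally show ?thesis .
  qed
  define R :: "'n square_matrix" where "R = (\<chi> r k. w k $ r)"
  have col: "column k R = w k" for k
    by (simp add: R_def column_def vec_eq_iff)
  have orthR: "orthogonal_matrix R"
    unfolding orthogonal_matrix_orthonormal_columns col using w_norm w_orth
    by (simp add: orthogonal_def)
  have comm: "P $ i ** R = R ** standard_flag q $ i" for i
  proof -
    have "(P $ i ** R) $ r $ k = (R ** standard_flag q $ i) $ r $ k" for r k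
    proof -
      have "(P $ i ** R) $ r $ k = (P $ i *v w k) $ r"
        by (simp add: matrix_matrix_mult_def matrix_vector_mult_def R_def)
      moreover have "(R ** standard_flag q $ i) $ r $ k =
          (\<Sum>m\<in>UNIV. if m = k then (if k \<in> block q i then w k $ r else 0) else 0)"
        unfolding matrix_matrix_mult_def standard_flag_def R_def vec_lambda_beta by (rule sum.cong) auto
      ultimately show ?thesis
        by (simp add: w_fix)
    qed
    then show ?thesis
      by (simp add: vec_eq_iff)
  qed
  have action: "flag_action Q (standard_flag q) = P"
    if "orthogonal_matrix Q" "\<And>i. P $ i ** Q = Q ** standard_flag q $ i" for Q
  proof -
    have "Q ** standard_flag q $ i ** transpose Q = P $ i" for i
      unfolding that(2)[symmetric] using that(1)
      by (simp add: orthogonal_matrix_def flip: matrix_mul_assoc)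
    then show ?thesis
      by (simp add: flag_action_def vec_eq_iff)
  qed
  \<comment> \<open>An arbitrary index, whose column \<open>D\<close> negates. Being diagonal,
    \<open>D\<close> commutes with the standard flag, so \<open>R ** D\<close> diagonalises the same
    projections with the opposite determinant.\<close>
  obtain k0 :: 'n where True
    by simp
  define D :: "'n square_matrix" where "D = (\<chi> k l. if k = l then (if k = k0 then -1 else 1) else 0)"
  have D: "D ** D = mat 1" "transpose D = D" "D ** standard_flag q $ i = standard_flag q $ i ** D" for i
  proof -
    have mult: "(D ** A) $ k $ l = (if k = k0 then - A $ k $ l else A $ k $ l)"
      for A :: "'n square_matrix" and k l
    proof -
      have "(D ** A) $ k $ l = (\<Sum>m\<in>UNIV. if k = m then (if k = k0 then - A $ k $ l else A $ k $ l) else 0)"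
        unfolding matrix_matrix_mult_def D_def vec_lambda_beta by (rule sum.cong) auto
      then show ?thesis
        by simp
    qed
    show "transpose D = D"
      by (auto simp: D_def transpose_def vec_eq_iff)
    then have "(A ** D) $ k $ l = (if l = k0 then - A $ k $ l else A $ k $ l)" for A :: "'n square_matrix" and k l
      using mult[of "transpose A" l k] matrix_transpose_mul[of A D] by (simp add: transpose_def vec_eq_iff)
    then show "D ** standard_flag q $ i = standard_flag q $ i ** D"
      using mult by (auto simp: vec_eq_iff standard_flag_def)
    show "D ** D = mat 1"
      using mult by (auto simp: vec_eq_iff D_def mat_def)
  qed
  have detD: "det D = -1"
  proof -
    have "det D = (\<Prod>k\<in>UNIV. D $ k $ k)"
      by (rule det_diagonal) (simp add: D_def)
    also have "\<dots> = (\<Prod>k\<in>UNIV. if k = k0 then -1 else 1)"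
      by (simp add: D_def)
    finally show ?thesis
      by simp
  qed
  have "orthogonal_matrix D"
    using D by (simp add: orthogonal_matrix)
  then have orthRD: "orthogonal_matrix (R ** D)"
    using orthR by (rule orthogonal_matrix_mul[rotated])
  have commD: "P $ i ** (R ** D) = (R ** D) ** standard_flag q $ i" for i
    using comm[of i] D(3)[of i] by (metis matrix_mul_assoc)
  consider "det R = 1" | "det R = -1"
    using det_orthogonal_matrix[OF orthR] by blast
  then show thesis
  proof cases
    case 1
    then show ?thesis
      using that[of R] action[OF orthR comm] orthR
      by (simp add: special_orthogonal_def rotation_matrix_def)
  next
    case 2
    then show ?thesis
      using that[of "R ** D"] action[OF orthRD commD] orthRD detD
      by (simp add: special_orthogonal_def rotation_matrix_def det_mul)
  qed
qed

end

lemma rank_conjugate: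
  fixes P :: "real^'n^'n"
  assumes "Q \<in> special_orthogonal"
  shows "rank (Q ** P ** transpose Q) = rank P"
proof (rule antisym)
  show "rank (Q ** P ** transpose Q) \<le> rank P"
    using rank_mul_le_left[of "Q ** P" "transpose Q"] rank_mul_le_right[of Q P] by linarith
  have "P = transpose Q ** (Q ** P ** transpose Q) ** Q"
    using assms by (simp add: special_orthogonal_iff matrix_mul_assoc)
      (simp add: special_orthogonal_iff flip: matrix_mul_assoc)
  then show "rank P \<le> rank (Q ** P ** transpose Q)"
    using rank_mul_le_left[of "transpose Q ** (Q ** P ** transpose Q)" Q]
      rank_mul_le_right[of "transpose Q" "Q ** P ** transpose Q"] by simp
qed

lemma conjugate_mult:
  assumes "Q \<in> special_orthogonal"
  shows "(Q ** A ** transpose Q) ** (Q ** B ** transpose Q) = Q ** (A ** B) ** transpose Q"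
proof -
  have "(Q ** A ** transpose Q) ** (Q ** B ** transpose Q) =
      Q ** A ** (transpose Q ** Q) ** B ** transpose Q"
    by (simp add: matrix_mul_assoc)
  also have "\<dots> = Q ** A ** B ** transpose Q"
    using assms by (simp add: special_orthogonal_iff)
  finally show ?thesis
    by (simp add: matrix_mul_assoc)
qed

lemma transpose_conjugate: "transpose (Q ** A ** transpose Q) = Q ** transpose A ** transpose Q"
  for Q A :: "real^'n^'n"
  by (simp add: matrix_transpose_mul matrix_mul_assoc)

lemma flag_action_flag_manifold:
  assumes "Q \<in> special_orthogonal" "P \<in> flag_manifold q"
  shows "flag_action Q P \<in> flag_manifold q"
  using assms(2) by (simp add: flag_manifold_def grassmannian_def flag_action_def
      conjugate_mult[OF assms(1)] rank_conjugate[OF assms(1)] transpose_conjugate)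

lemma resolution_flag_action:
  assumes "Q \<in> special_orthogonal" "resolution P"
  shows "resolution (flag_action Q P)"
proof -
  have "(\<Sum>i\<in>UNIV. Q ** P $ i ** transpose Q) = Q ** (\<Sum>i\<in>UNIV. P $ i) ** transpose Q"
    by (simp add: matmul.sum_left matmul.sum_right)
  then show ?thesis
    using assms(2) conjugate_mult[OF assms(1)] assms(1)
    by (simp add: resolution_def flag_action_def transpose_conjugate special_orthogonal_iff)
qed

text \<open>The sum condition holds for the standard flag and is preserved by conjugation, so
  transitivity carries it to every flag.\<close>

lemma resolution_flag:
  fixes q :: "'r::{finite,linorder} \<Rightarrow> nat"
    and P :: "real^('n::{finite,linorder})^('n::{finite,linorder})^('r::{finite,linorder})"
  assumes sum_q: "(\<Sum>i\<in>UNIV. q i) = CARD('n)" and "P \<in> flag_manifold q"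
  shows "resolution P"
proof -
  obtain Q where "Q \<in> special_orthogonal" "flag_action Q (standard_flag q) = P"
    by (rule flag_action_transitive[OF assms])
  then show ?thesis
    using resolution_flag_action resolution_standard_flag[OF sum_q] by metis
qed

section \<open>Commutator algebra of matrix tuples\<close>

definition tuple_ad :: "real^'n^'n \<Rightarrow> real^'n^'n^'r \<Rightarrow> real^'n^'n^('r::finite)" where
  "tuple_ad A V = (\<chi> i. commutator A (V $ i))"

text \<open>For a tuple \<open>W\<close> of symmetric matrices,
  \<open>\<lambda>V. tuple_coad V W\<close> is the adjoint of
  \<open>\<lambda>A. tuple_ad A W\<close>; see \<open>tuple_ad_adjoint\<close>.\<close>

definition tuple_coad :: "real^'n^'n^'r \<Rightarrow> real^'n^'n^('r::finite) \<Rightarrow> real^'n^'n" where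
  "tuple_coad V W = (\<Sum>i\<in>UNIV. commutator (V $ i) (W $ i))"

text \<open>For a resolution \<open>P\<close>, the orthogonal projection onto the matrices commuting
  with all \<open>P $ i\<close>; its skew values form the Lie algebra of the isotropy group.\<close>

definition block_diag :: "real^'n^'n^('r::finite) \<Rightarrow> real^'n^'n \<Rightarrow> real^'n^'n" where
  "block_diag P A = (\<Sum>i\<in>UNIV. P $ i ** A ** P $ i)"

lemma bounded_bilinear_tuple_ad: "bounded_bilinear (tuple_ad :: _ \<Rightarrow> _ \<Rightarrow> real^'n^'n^('r::finite))"
  unfolding bilinear_conv_bounded_bilinear[symmetric] bilinear_def
  by (auto intro!: linearI simp: tuple_ad_def vec_eq_iff[where 'b = 'r] commutator.add_left
      commutator.add_right commutator.scaleR_left commutator.scaleR_right)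

interpretation tuple_ad: bounded_bilinear "tuple_ad :: _ \<Rightarrow> _ \<Rightarrow> real^'n^'n^('r::finite)"
  by (rule bounded_bilinear_tuple_ad)

lemma bounded_bilinear_tuple_coad:
  "bounded_bilinear (tuple_coad :: real^'n^'n^('r::finite) \<Rightarrow> _ \<Rightarrow> _)"
  unfolding bilinear_conv_bounded_bilinear[symmetric] bilinear_def
  by (auto intro!: linearI simp: tuple_coad_def commutator.add_left sum.distrib scaleR_sum_right
      commutator.add_right commutator.scaleR_left commutator.scaleR_right)

interpretation tuple_coad: bounded_bilinear "tuple_coad :: real^'n^'n^('r::finite) \<Rightarrow> _ \<Rightarrow> _"
  by (rule bounded_bilinear_tuple_coad)

lemma tuple_ad_skew:
  "transpose A = - A \<Longrightarrow> tuple_ad A V \<bullet> W = - (V \<bullet> tuple_ad A W)"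
  for V W :: "real^'n^'n^('r::finite)"
  unfolding inner_vec_def[where 'b = 'r]
  by (simp add: tuple_ad_def inner_commutator_skew sum_negf)

lemma tuple_ad_jacobi: "tuple_ad (commutator A B) V = tuple_ad A (tuple_ad B V) - tuple_ad B (tuple_ad A V)"
  for V :: "real^'n^'n^('r::finite)"
  by (simp add: tuple_ad_def vec_eq_iff[where 'b = 'r] commutator_jacobi)

lemma tuple_ad_adjoint:
  assumes "\<And>i. transpose (P $ i) = P $ i"
  shows "tuple_ad A P \<bullet> V = A \<bullet> tuple_coad V P"
proof -
  have "tuple_ad A P \<bullet> V = (\<Sum>i\<in>UNIV. tuple_ad A P $ i \<bullet> V $ i)"
    by (rule inner_vec_def)
  then show ?thesis
    by (simp add: tuple_ad_def tuple_coad_def inner_sum_right inner_commutator_symmetric[OF assms])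
qed

lemma block_diag_component:
  assumes "resolution P"
  shows "P $ i ** block_diag P A = P $ i ** A ** P $ i" "block_diag P A ** P $ i = P $ i ** A ** P $ i"
proof -
  have "P $ i ** block_diag P A = (\<Sum>j\<in>UNIV. if j = i then P $ i ** A ** P $ i else 0)"
    unfolding block_diag_def matmul.sum_right
    by (rule sum.cong) (auto simp: matmul_simps resolutionD[OF assms])
  then show "P $ i ** block_diag P A = P $ i ** A ** P $ i"
    by simp
  have "block_diag P A ** P $ i = (\<Sum>j\<in>UNIV. if j = i then P $ i ** A ** P $ i else 0)"
    unfolding block_diag_def matmul.sum_left
    by (rule sum.cong) (auto simp: matmul_simps resolutionD[OF assms])
  then show "block_diag P A ** P $ i = P $ i ** A ** P $ i"
    by simp
qed

lemma tuple_ad_block_diag: "resolution P \<Longrightarrow> tuple_ad (block_diag P A) P = 0"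
  for P :: "real^'n^'n^('r::finite)"
  by (simp add: tuple_ad_def commutator_def block_diag_component vec_eq_iff[where 'b = 'r])

lemma block_diag_idem: "resolution P \<Longrightarrow> block_diag P (block_diag P A) = block_diag P A"
  by (simp add: block_diag_def[of P "block_diag P A"] block_diag_component matmul_simps resolutionD)
    (simp add: block_diag_def)

lemma block_diag_adjoint:
  assumes "resolution P"
  shows "block_diag P A \<bullet> B = A \<bullet> block_diag P B"
  by (simp add: block_diag_def inner_sum_left inner_sum_right inner_mult_right[of "P $ _ ** A"]
      inner_mult_left[of "P $ _" A] resolutionD[OF assms] matrix_mul_assoc)

lemma transpose_block_diag: "resolution P \<Longrightarrow> transpose (block_diag P A) = block_diag P (transpose A)"
  by (simp add: block_diag_def transpose_simps resolutionD matmul_simps)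

lemma block_diag_minus: "block_diag P (- A) = - block_diag P A"
  by (simp add: block_diag_def matmul_simps sum_negf)

text \<open>For a projection p, [[A, p], p] = A p + p A - 2 p A p; the sum over a resolution yields
  \<open>A\<close> twice. The double commutators of the curvature formula are evaluated by
  this.\<close>

lemma tuple_coad_ad:
  assumes "resolution P"
  shows "tuple_coad (tuple_ad A P) P = 2 *\<^sub>R (A - block_diag P A)"
proof -
  have "commutator (commutator A (P $ i)) (P $ i) =
      A ** P $ i + P $ i ** A - 2 *\<^sub>R (P $ i ** A ** P $ i)" for i
    by (simp add: commutator_def matmul_simps resolutionD[OF assms] scaleR_2)
  then have "tuple_coad (tuple_ad A P) P =
      A ** (\<Sum>i\<in>UNIV. P $ i) + (\<Sum>i\<in>UNIV. P $ i) ** A - 2 *\<^sub>R block_diag P A"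
    by (simp add: tuple_coad_def tuple_ad_def block_diag_def matmul.sum_left matmul.sum_right
        sum.distrib sum_subtractf scaleR_sum_right)
  then show ?thesis
    by (simp add: resolutionD(4)[OF assms] scaleR_2 scaleR_diff_right)
qed

text \<open>If p A p = 0 and p B p = 0, then [[B, p], [A, p]] = A p B - B p A + p [A, B] p; summing,
  the middle projections add up to the identity.\<close>

lemma tuple_coad_ad_ad:
  assumes P: "resolution P" and A: "block_diag P A = 0" and B: "block_diag P B = 0"
  shows "tuple_coad (tuple_ad B P) (tuple_ad A P) = commutator A B + block_diag P (commutator A B)"
proof -
  have zero: "P $ i ** A ** P $ i = 0" "P $ i ** B ** P $ i = 0" for i
    using block_diag_component(1)[OF P, of i A] block_diag_component(1)[OF P, of i B] A B
    by (simp_all add: matmul.zero_right)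
  \<comment> \<open>Products are normalised with brackets to the left, so the vanishing factors must
    also be recognised behind a prefix \<open>X\<close>.\<close>
  have zero': "X ** P $ i ** A ** P $ i = 0" "X ** P $ i ** B ** P $ i = 0" for i X
    using zero[of i] by (metis matrix_mul_assoc matmul.zero_right)+
  have "commutator (commutator B (P $ i)) (commutator A (P $ i)) =
     A ** P $ i ** B - B ** P $ i ** A + P $ i ** commutator A B ** P $ i" for i
    by (simp add: commutator_def matmul_simps resolutionD[OF P] zero zero')
  then have "tuple_coad (tuple_ad B P) (tuple_ad A P) = A ** (\<Sum>i\<in>UNIV. P $ i) ** B
      - B ** (\<Sum>i\<in>UNIV. P $ i) ** A + block_diag P (commutator A B)"
    by (simp add: tuple_coad_def tuple_ad_def block_diag_def matmul.sum_left matmul.sum_right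
        sum.distrib sum_subtractf)
  then show ?thesis
    by (simp add: resolutionD(4)[OF P] commutator_def)
qed

text \<open>The assumptions are the linearised flag equations. They determine each block
  \<open>P $ j ** v $ j ** P $ i\<close> in terms of \<open>v $ i\<close> alone, so the sum over
  \<open>j\<close> collapses and \<open>v\<close> is recovered as an infinitesimal rotation of
  \<open>P\<close>.\<close>

lemma resolution_tangent:
  assumes P: "resolution P" and sym: "\<And>i. transpose (v $ i) = v $ i"
    and idem: "\<And>i. v $ i ** P $ i + P $ i ** v $ i = v $ i"
    and orth: "\<And>i j. i \<noteq> j \<Longrightarrow> v $ i ** P $ j + P $ i ** v $ j = 0"
  shows "tuple_ad (tuple_coad v P) P = 2 *\<^sub>R v"
    and "transpose (tuple_coad v P) = - tuple_coad v P"
    and "block_diag P (tuple_coad v P) = 0"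
proof -
  have self: "P $ i ** v $ i ** P $ i = 0" for i
  proof -
    have "P $ i ** (v $ i ** P $ i + P $ i ** v $ i) ** P $ i = P $ i ** v $ i ** P $ i"
      by (simp add: idem)
    then show ?thesis
      by (simp add: matmul_simps resolutionD[OF P])
  qed
  have left: "P $ j ** v $ j ** P $ i = (if j = i then P $ i ** v $ i else 0) - P $ j ** v $ i" for i j
  proof (cases "j = i")
    case False
    then have "P $ j ** (v $ j ** P $ i + P $ j ** v $ i) = 0"
      by (simp add: orth)
    then show ?thesis
      using False by (simp add: matmul_simps resolutionD[OF P] eq_neg_iff_add_eq_0)
  qed (simp add: self)
  have right: "P $ i ** v $ j ** P $ j = (if j = i then v $ i ** P $ i else 0) - v $ i ** P $ j" for i j
  proof (cases "j = i")
    case False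
    then have "(v $ i ** P $ j + P $ i ** v $ j) ** P $ j = 0"
      by (simp add: orth)
    then show ?thesis
      using False by (simp add: matmul_simps resolutionD[OF P] eq_neg_iff_add_eq_0 add.commute)
  qed (simp add: self)
  have "commutator (tuple_coad v P) (P $ i) = 2 *\<^sub>R v $ i" for i
  proof -
    have "tuple_coad v P ** P $ i =
        (\<Sum>j\<in>UNIV. (if j = i then v $ i ** P $ i - P $ i ** v $ i else 0) + P $ j ** v $ i)"
      unfolding tuple_coad_def matmul.sum_left commutator_def
      by (rule sum.cong) (auto simp: matmul_simps left resolutionD[OF P])
    also have "\<dots> = v $ i ** P $ i - P $ i ** v $ i + v $ i"
      by (simp add: sum.distrib resolutionD(4)[OF P] flip: matmul.sum_left)
    finally have 1: "tuple_coad v P ** P $ i = v $ i ** P $ i - P $ i ** v $ i + v $ i" .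
    have "P $ i ** tuple_coad v P =
        (\<Sum>j\<in>UNIV. (if j = i then v $ i ** P $ i - P $ i ** v $ i else 0) - v $ i ** P $ j)"
      unfolding tuple_coad_def matmul.sum_right commutator_def
      by (rule sum.cong) (auto simp: matmul_simps right resolutionD[OF P])
    also have "\<dots> = v $ i ** P $ i - P $ i ** v $ i - v $ i"
      by (simp add: sum_subtractf resolutionD(4)[OF P] flip: matmul.sum_right)
    finally show ?thesis
      using 1 by (simp add: commutator_def scaleR_2)
  qed
  then show "tuple_ad (tuple_coad v P) P = 2 *\<^sub>R v"
    by (simp add: tuple_ad_def vec_eq_iff[where 'b = 'b])
  show "transpose (tuple_coad v P) = - tuple_coad v P"
    by (simp add: tuple_coad_def transpose_simps transpose_commutator sym resolutionD[OF P]
        commutator_swap[of "P $ _"] sum_negf)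
  have "P $ i ** tuple_coad v P ** P $ i = 0" for i
  proof -
    have "P $ i ** tuple_coad v P ** P $ i =
        (\<Sum>j\<in>UNIV. P $ i ** (v $ j ** P $ j - P $ j ** v $ j) ** P $ i)"
      by (simp add: tuple_coad_def commutator_def matmul.sum_left matmul.sum_right)
    also have "\<dots> = 0"
    proof (intro sum.neutral ballI)
      fix j
      show "P $ i ** (v $ j ** P $ j - P $ j ** v $ j) ** P $ i = 0"
        by (cases "i = j") (simp_all add: matmul_simps resolutionD[OF P] self)
    qed
    finally show ?thesis .
  qed
  then show "block_diag P (tuple_coad v P) = 0"
    by (simp add: block_diag_def)
qed

subsection \<open>Curvature of the flag manifold\<close>

text \<open>Conjugation is quadratic in \<open>Q\<close>; as a bilinear map on the diagonal it falls
  under the product rule.\<close>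

lemma bounded_bilinear_conjugate:
  "bounded_bilinear (\<lambda>Q R. \<chi> i. Q ** P $ i ** transpose R)" for P :: "real^'n^'n^('r::finite)"
  unfolding bilinear_conv_bounded_bilinear[symmetric] bilinear_def
  by (auto intro!: linearI simp: vec_eq_iff[where 'b = 'r] matmul_simps transpose_simps)

lemma tuple_ad_tangent:
  assumes P: "P \<in> flag_manifold q" and A: "transpose A = - A"
  shows "tuple_ad A P \<in> tangent_space (flag_manifold q) P"
proof -
  obtain \<gamma> where \<gamma>: "smooth_on UNIV \<gamma>" "\<And>t::real. \<gamma> t \<in> special_orthogonal" "\<gamma> 0 = mat 1"
    "(\<gamma> has_vector_derivative A) (at 0)"
    using SO_velocity_skew[OF A] unfolding SO_velocity_def by metis
  let ?c = "\<lambda>t. flag_action (\<gamma> t) P"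
  have "smooth_on UNIV ?c"
    unfolding flag_action_def by (rule smooth_on_bilinear[OF _ bounded_bilinear_conjugate \<gamma>(1) \<gamma>(1)]) simp
  moreover have "(?c has_vector_derivative tuple_ad A P) (at 0)"
  proof -
    have "(?c has_vector_derivative (\<chi> i. \<gamma> 0 ** P $ i ** transpose A) + (\<chi> i. A ** P $ i ** transpose (\<gamma> 0)))
        (at 0)"
      unfolding flag_action_def
      by (rule bounded_bilinear.has_vector_derivative[OF bounded_bilinear_conjugate \<gamma>(4) \<gamma>(4)])
    moreover have "(\<chi> i. \<gamma> 0 ** P $ i ** transpose A) + (\<chi> i. A ** P $ i ** transpose (\<gamma> 0)) = tuple_ad A P"
      by (simp add: \<gamma>(3) A tuple_ad_def commutator_def matmul_simps vec_eq_iff[where 'b = 'b])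
    ultimately show ?thesis
      by simp
  qed
  moreover have "?c 0 = P"
    by (simp add: \<gamma>(3) flag_action_def)
  ultimately show ?thesis
    unfolding tangent_space_def using flag_action_flag_manifold[OF \<gamma>(2) P]
    by (intro CollectI exI[of _ ?c] exI[of _ 1]) (auto intro: smooth_on_subset[of UNIV])
qed

text \<open>The defining equations of a flag, differentiated along \<open>v\<close>; they are the
  assumptions of \<open>resolution_tangent\<close>.\<close>

lemma tangent_flag_manifold:
  assumes v: "v \<in> tangent_space (flag_manifold q) P"
  shows "transpose (v $ i) = v $ i" "v $ i ** P $ i + P $ i ** v $ i = v $ i"
    and "i \<noteq> j \<Longrightarrow> v $ i ** P $ j + P $ i ** v $ j = 0"
proof -
  let ?F = "flag_manifold q"
  have nth: "bounded_linear (\<lambda>P. P $ i)" for i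
    by (rule bounded_linear_vec_nth)
  have prod: "dmap ?F (\<lambda>P. P $ i ** P $ j) P v = P $ i ** v $ j + v $ i ** P $ j" for i j
    using dmap_bilinear[OF bounded_bilinear_matrix_mult smooth_map_linear[OF nth[of i]]
        smooth_map_linear[OF nth[of j]] v] dmap_linear[OF nth v] by simp
  have "dmap ?F (\<lambda>P. transpose (P $ i)) P = dmap ?F (\<lambda>P. P $ i) P"
    by (rule dmap_cong[OF tangent_space_in[OF v]]) (simp add: flag_manifold_def grassmannian_def)
  then show "transpose (v $ i) = v $ i"
    using dmap_linear[OF bounded_linear_compose[OF bounded_linear_transpose nth[of i]] v]
      dmap_linear[OF nth v] by simp
  have "dmap ?F (\<lambda>P. P $ i ** P $ i) P = dmap ?F (\<lambda>P. P $ i) P"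
    by (rule dmap_cong[OF tangent_space_in[OF v]]) (simp add: flag_manifold_def grassmannian_def)
  then show "v $ i ** P $ i + P $ i ** v $ i = v $ i"
    using prod[of i i] dmap_linear[OF nth v] by (simp add: add.commute)
  show "v $ i ** P $ j + P $ i ** v $ j = 0" if "i \<noteq> j"
    using dmap_constant_on[OF v, of "\<lambda>P. P $ i ** P $ j" 0] prod[of i j] that
    by (simp add: flag_manifold_def add.commute)
qed

text \<open>The skew matrix \<open>A\<close> with vanishing diagonal blocks for which \<open>v = ([A, P\<^sub>i])\<^sub>i\<close>.\<close>

definition flag_velocity :: "real^'n^'n^('r::finite) \<Rightarrow> real^'n^'n^'r \<Rightarrow> real^'n^'n" where
  "flag_velocity P v = (1/2) *\<^sub>R tuple_coad v P"

definition tuple_sym :: "real^'n^'n^('r::finite) \<Rightarrow> real^'n^'n^'r" where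
  "tuple_sym V = (\<chi> i. (1/2) *\<^sub>R (V $ i + transpose (V $ i)))"

text \<open>Symmetrising first makes the inner commutator sum skew, so on a flag every ambient tuple
  is sent to an infinitesimal rotation of \<open>P\<close>. The formula is quadratic in
  \<open>P\<close>, which makes its derivative explicit.\<close>

definition flag_proj :: "real^'n^'n^('r::finite) \<Rightarrow> real^'n^'n^'r \<Rightarrow> real^'n^'n^'r" where
  "flag_proj P V = (1/2) *\<^sub>R tuple_ad (tuple_coad (tuple_sym V) P) P"

lemma linear_tuple_sym: "linear (tuple_sym :: real^'n^'n^('r::finite) \<Rightarrow> _)"
  by (rule linearI) (simp_all add: tuple_sym_def vec_eq_iff[where 'b = 'r] transpose_simps
      scaleR_add_right algebra_simps)

lemma linear_flag_proj: "linear (flag_proj P)"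
  by (rule linearI) (simp_all add: flag_proj_def linear_add[OF linear_tuple_sym]
      linear_cmul[OF linear_tuple_sym] tuple_coad.add_left tuple_coad.scaleR_left tuple_ad.add_left
      tuple_ad.scaleR_left scaleR_add_right)

lemma smooth_map_coad: "smooth_map S (\<lambda>P. tuple_coad W P)"
  by (rule smooth_map_linear[OF tuple_coad.bounded_linear_right])

lemma smooth_map_flag_proj: "smooth_map S (\<lambda>P. flag_proj P V)"
  unfolding flag_proj_def
  by (intro smooth_map_linear_compose[OF bounded_linear_scaleR_right]
      smooth_map_bilinear[OF bounded_bilinear_tuple_ad] smooth_map_coad
      smooth_map_linear[OF bounded_linear_ident])

lemma dmap_flag_proj:
  assumes "v \<in> tangent_space S P"
  shows "dmap S (\<lambda>P. flag_proj P V) P v =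
    (1/2) *\<^sub>R (tuple_ad (tuple_coad (tuple_sym V) P) v + tuple_ad (tuple_coad (tuple_sym V) v) P)"
  unfolding flag_proj_def
  by (subst dmap_linear_compose[OF bounded_linear_scaleR_right
          smooth_map_bilinear[OF bounded_bilinear_tuple_ad smooth_map_coad
            smooth_map_linear[OF bounded_linear_ident]] assms],
      subst dmap_bilinear[OF bounded_bilinear_tuple_ad smooth_map_coad
        smooth_map_linear[OF bounded_linear_ident] assms])
     (simp add: dmap_linear[OF tuple_coad.bounded_linear_right assms]
        dmap_linear[OF bounded_linear_ident assms])

text \<open>As the \<open>P $ i\<close> are symmetric, symmetrising \<open>V\<close> amounts to
  taking the skew part of the commutator sum.\<close>

lemma tuple_coad_tuple_sym:
  assumes "resolution P"
  shows "tuple_coad (tuple_sym V) P = (1/2) *\<^sub>R (tuple_coad V P - transpose (tuple_coad V P))"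
  by (simp add: tuple_coad_def tuple_sym_def transpose_simps transpose_commutator
      commutator_swap[of "P $ _"] resolutionD[OF assms] commutator.add_left commutator.scaleR_left
      sum_negf sum.distrib scaleR_sum_right scaleR_add_right)

text \<open>Tangent vectors of the group are written as right translates \<open>A ** x\<close>,
  because the differential of the orbit map is then the infinitesimal action of \<open>A\<close> at
  the image point.\<close>

lemma dmap_orbit_map:
  fixes P :: "real^'n^'n^('r::finite)"
  assumes x: "x \<in> special_orthogonal" and A: "transpose A = - A"
  shows "A ** x \<in> tangent_space special_orthogonal x"
    and "dmap special_orthogonal (\<lambda>Q. flag_action Q P) x (A ** x) = tuple_ad A (flag_action x P)"
proof -
  show tan: "A ** x \<in> tangent_space special_orthogonal x"
    using x A by (simp add: tangent_space_special_orthogonal transpose_simps matmul_simps)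
  have "dmap special_orthogonal (\<lambda>Q. flag_action Q P) x (A ** x) =
      (\<chi> i. x ** P $ i ** transpose (A ** x)) + (\<chi> i. A ** x ** P $ i ** transpose x)"
    unfolding flag_action_def
    using dmap_bilinear[OF bounded_bilinear_conjugate smooth_map_linear[OF bounded_linear_ident]
        smooth_map_linear[OF bounded_linear_ident] tan] dmap_linear[OF bounded_linear_ident tan] by simp
  then show "dmap special_orthogonal (\<lambda>Q. flag_action Q P) x (A ** x) = tuple_ad A (flag_action x P)"
    by (simp add: tuple_ad_def flag_action_def commutator_def transpose_simps A matmul_simps
        vec_eq_iff[where 'b = 'r])
qed

context
  fixes q :: "'r::{finite,linorder} \<Rightarrow> nat"
  assumes sum_q: "(\<Sum>i\<in>UNIV. q i) = CARD('n::{finite,linorder})"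
begin

private abbreviation (input) "F \<equiv> flag_manifold q :: ('n, 'r) matrix_tuple set"

lemma flag_velocity:
  assumes "v \<in> tangent_space F P"
  shows "tuple_ad (flag_velocity P v) P = v" "transpose (flag_velocity P v) = - flag_velocity P v"
    and "block_diag P (flag_velocity P v) = 0" "tuple_coad v P = 2 *\<^sub>R flag_velocity P v"
proof -
  note res = resolution_flag[OF sum_q tangent_space_in[OF assms]]
  note T = resolution_tangent[OF res tangent_flag_manifold[OF assms]]
  show "tuple_ad (flag_velocity P v) P = v"
    using T(1) by (simp add: flag_velocity_def tuple_ad.scaleR_left)
  show "transpose (flag_velocity P v) = - flag_velocity P v"
    using T(2) by (simp add: flag_velocity_def transpose_simps)
  show "block_diag P (flag_velocity P v) = 0"
    using T(3) by (simp add: flag_velocity_def block_diag_def matmul_simps flip: scaleR_sum_right)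
  show "tuple_coad v P = 2 *\<^sub>R flag_velocity P v"
    by (simp add: flag_velocity_def)
qed

lemma tuple_sym_tangent: "v \<in> tangent_space F P \<Longrightarrow> tuple_sym v = v"
  by (simp add: tuple_sym_def tangent_flag_manifold(1) vec_eq_iff[where 'b = 'r] flip: scaleR_2)

text \<open>With C = [A, B], differentiating the two occurrences of \<open>P\<close> gives half of 2
  ad B ad A P + ad C P, as the block diagonal part of C acts trivially on \<open>P\<close>;
  expanding ad C by the Jacobi identity symmetrises the result.\<close>

lemma flag_second_fundamental_form:
  assumes v: "v \<in> tangent_space F P" and w: "w \<in> tangent_space F P"
  defines "A \<equiv> flag_velocity P v" and "B \<equiv> flag_velocity P w"
  shows "dmap F (\<lambda>P. flag_proj P w) P v =
    (1/2) *\<^sub>R (tuple_ad A (tuple_ad B P) + tuple_ad B (tuple_ad A P))"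
proof -
  note res = resolution_flag[OF sum_q tangent_space_in[OF v]]
  have "tuple_coad w v = commutator A B + block_diag P (commutator A B)"
    using tuple_coad_ad_ad[OF res, of A B] flag_velocity[OF v] flag_velocity[OF w]
    by (simp add: A_def B_def)
  moreover have "tuple_coad w P = B + B"
    using flag_velocity(4)[OF w] by (simp add: B_def scaleR_2)
  ultimately have "dmap F (\<lambda>P. flag_proj P w) P v = (1/2) *\<^sub>R (tuple_ad (B + B) v
      + tuple_ad (commutator A B + block_diag P (commutator A B)) P)"
    unfolding dmap_flag_proj[OF v] tuple_sym_tangent[OF w] by simp
  also have "tuple_ad (B + B) v = tuple_ad (B + B) (tuple_ad A P)"
    using flag_velocity(1)[OF v] by (simp add: A_def)
  finally show ?thesis
    by (simp only: tuple_ad.add_left tuple_ad_block_diag[OF res] tuple_ad_jacobi) simp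
qed

lemma projected_submanifold_flag: "projected_submanifold F flag_proj"
proof (rule projected_submanifold.intro)
  show "smooth_map F (\<lambda>x. flag_proj x w)" for w
    by (rule smooth_map_flag_proj)
  show "linear (flag_proj P)" if "P \<in> F" for P
    by (rule linear_flag_proj)
  show "flag_proj P V \<in> tangent_space F P" if "P \<in> F" for P V
  proof -
    have "transpose ((1/2) *\<^sub>R tuple_coad (tuple_sym V) P) = - ((1/2) *\<^sub>R tuple_coad (tuple_sym V) P)"
      using tuple_coad_tuple_sym[OF resolution_flag[OF sum_q that], of V]
      by (simp add: transpose_simps flip: scaleR_minus_right)
    from tuple_ad_tangent[OF that this] show ?thesis
      by (simp add: flag_proj_def tuple_ad.scaleR_left)
  qed
  show "flag_proj P v = v" if "v \<in> tangent_space F P" for P v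
    using flag_velocity[OF that] tuple_sym_tangent[OF that]
    by (simp add: flag_proj_def tuple_ad.scaleR_left)
  show "flag_proj P V \<bullet> W = V \<bullet> flag_proj P W" if "P \<in> F" for P V W
  proof -
    note res = resolution_flag[OF sum_q that]
    \<comment> \<open>The right-hand side is symmetric in \<open>V\<close> and \<open>W\<close>,
      which gives self-adjointness. As \<open>?K\<close> is skew, it only sees the skew part of
      \<open>tuple_coad W P\<close>.\<close>
    have half: "flag_proj P V \<bullet> W = (1/2) * (tuple_coad (tuple_sym V) P \<bullet> tuple_coad (tuple_sym W) P)"
      for V W
    proof -
      let ?K = "tuple_coad (tuple_sym V) P"
      have "transpose ?K = - ?K"
        by (simp add: tuple_coad_tuple_sym[OF res] transpose_simps flip: scaleR_minus_right)
      then have "?K \<bullet> tuple_coad (tuple_sym W) P = ?K \<bullet> tuple_coad W P"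
        using inner_transpose[of ?K "tuple_coad W P"]
        by (simp add: tuple_coad_tuple_sym[OF res, of W] inner_diff_right)
      moreover have "tuple_ad ?K P \<bullet> W = ?K \<bullet> tuple_coad W P"
        by (rule tuple_ad_adjoint) (rule resolutionD[OF res])
      ultimately show ?thesis
        by (simp add: flag_proj_def)
    qed
    show ?thesis
      using half[of V W] half[of W V] by (simp add: inner_commute)
  qed
  show "dmap F (\<lambda>y. flag_proj y w) P v = dmap F (\<lambda>y. flag_proj y v) P w"
    if "v \<in> tangent_space F P" "w \<in> tangent_space F P" for P v w
    using that by (simp add: flag_second_fundamental_form add.commute)
qed


text \<open>Horizontal vectors at \<open>x\<close> are the \<open>A ** x\<close> with
  \<open>A\<close> skew and without diagonal blocks relative to the flag over which \<open>x\<close>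
  lies. Their products are A \<bullet> B / 2, those of their images 2 (A \<bullet> B). The
  \<open>THE\<close> demands this value for every \<open>x\<close> over \<open>P\<close> and all
  lifts, and one pair of lifts that attains it.\<close>

lemma flag_metric_eq:
  assumes v: "v \<in> tangent_space F P" and w: "w \<in> tangent_space F P"
  shows "flag_metric q P v w = 1/4 * (v \<bullet> w)"
proof -
  let ?SO = "special_orthogonal :: 'n square_matrix set"
  let ?f = "\<lambda>Q. flag_action Q (standard_flag q) :: ('n, 'r) matrix_tuple"
  let ?hor = "horizontal_space ?SO SO_metric ?f"
  have P: "P \<in> F"
    using v by (rule tangent_space_in)
  have metric: "SO_metric x a b = 1/2 * (a \<bullet> b)" if "x \<in> ?SO" for x a b
    using that inner_mult_left[of "transpose x" a "transpose x ** b"]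
    unfolding SO_metric_def inner_matrix_trace[symmetric]
    by (simp add: matrix_mul_assoc special_orthogonal_iff)
  have right: "(A ** x) \<bullet> (B ** x) = A \<bullet> B" if "x \<in> ?SO" for x A B
    using that inner_mult_right[of A x "B ** x"]
    by (simp add: special_orthogonal_iff flip: matrix_mul_assoc)
  have res: "resolution (?f x)" if "x \<in> ?SO" for x
    using that resolution_flag_action resolution_standard_flag[OF sum_q] by blast
  note dmap_f = dmap_orbit_map(2)[where P = "standard_flag q :: ('n, 'r) matrix_tuple"]
  have horizontal_imp: "\<exists>A. a = A ** x \<and> transpose A = - A \<and> block_diag (?f x) A = 0"
    if x: "x \<in> ?SO" and a: "a \<in> ?hor x" for x a
  proof -
    define A where "A = a ** transpose x"
    have a_eq: "a = A ** x"
      using x by (simp add: A_def special_orthogonal_iff flip: matrix_mul_assoc)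
    have "a \<in> tangent_space ?SO x"
      using a by (simp add: horizontal_space_def)
    then have "transpose (transpose x ** a) = - (transpose x ** a)"
      using tangent_space_special_orthogonal[OF x] by simp
    then have "x ** transpose (transpose x ** a) ** transpose x = - (x ** (transpose x ** a) ** transpose x)"
      by (simp add: matmul.minus_left matmul.minus_right)
    moreover have "x ** transpose (transpose x ** a) ** transpose x = transpose A"
      using x by (simp add: A_def transpose_simps special_orthogonal_iff flip: matrix_mul_assoc)
    moreover have "x ** (transpose x ** a) ** transpose x = A"
      using x by (simp add: A_def special_orthogonal_iff matrix_mul_assoc)
    ultimately have skew: "transpose A = - A"
      by simp
    \<comment> \<open>The diagonal part of \<open>A\<close> is vertical, so a horizontal vector is
      orthogonal to it; since \<open>block_diag\<close> is an orthogonal projection, that part is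
      zero.\<close>
    let ?D = "block_diag (?f x) A"
    have skewD: "transpose ?D = - ?D"
      by (simp add: transpose_block_diag[OF res[OF x]] skew block_diag_minus)
    have "?D ** x \<in> vertical_space ?SO ?f x"
      using dmap_orbit_map(1)[OF x skewD] dmap_f[OF x skewD] tuple_ad_block_diag[OF res[OF x]]
      by (simp add: vertical_space_def)
    then have "SO_metric x a (?D ** x) = 0"
      using a by (simp add: horizontal_space_def)
    then have "A \<bullet> ?D = 0"
      unfolding metric[OF x] a_eq right[OF x] by simp
    moreover have "?D \<bullet> ?D = A \<bullet> ?D"
      by (simp add: block_diag_adjoint[OF res[OF x], of A ?D] block_diag_idem[OF res[OF x]])
    ultimately show ?thesis
      using a_eq skew by auto
  qed
  have unique: "c = 1/4 * (v \<bullet> w)"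
    if x: "x \<in> ?SO" "a \<in> ?hor x" "b \<in> ?hor x" "dmap ?SO ?f x a = v" "dmap ?SO ?f x b = w"
      "c = SO_metric x a b" for c x a b
  proof -
    obtain A where A: "a = A ** x" "transpose A = - A" "block_diag (?f x) A = 0"
      using horizontal_imp[OF x(1,2)] by blast
    obtain B where B: "b = B ** x" "transpose B = - B" "block_diag (?f x) B = 0"
      using horizontal_imp[OF x(1,3)] by blast
    have "v \<bullet> w = tuple_ad A (?f x) \<bullet> tuple_ad B (?f x)"
      using x dmap_f[OF x(1) A(2)] dmap_f[OF x(1) B(2)] A B by simp
    also have "\<dots> = A \<bullet> tuple_coad (tuple_ad B (?f x)) (?f x)"
      by (rule tuple_ad_adjoint) (rule resolutionD[OF res[OF x(1)]])
    also have "\<dots> = 2 * (A \<bullet> B)"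
      by (simp add: tuple_coad_ad[OF res[OF x(1)]] B(3))
    finally show ?thesis
      unfolding x(6) metric[OF x(1)] A(1) B(1) right[OF x(1)] by simp
  qed
  have horizontal: "A ** x \<in> ?hor x"
    if x: "x \<in> ?SO" and A: "transpose A = - A" and D: "block_diag (?f x) A = 0" for x A
    unfolding horizontal_space_def
  proof (intro CollectI conjI ballI)
    show "A ** x \<in> tangent_space ?SO x"
      by (rule dmap_orbit_map(1)[OF x A])
    fix b assume b: "b \<in> vertical_space ?SO ?f x"
    define B where "B = b ** transpose x"
    have b_eq: "b = B ** x"
      using x by (simp add: B_def special_orthogonal_iff flip: matrix_mul_assoc)
    have "transpose (transpose x ** b) = - (transpose x ** b)"
      using b tangent_space_special_orthogonal[OF x] by (simp add: vertical_space_def)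
    then have "x ** transpose (transpose x ** b) ** transpose x = - (x ** (transpose x ** b) ** transpose x)"
      by (simp add: matmul.minus_left matmul.minus_right)
    moreover have "x ** transpose (transpose x ** b) ** transpose x = transpose B"
      using x by (simp add: B_def transpose_simps special_orthogonal_iff flip: matrix_mul_assoc)
    moreover have "x ** (transpose x ** b) ** transpose x = B"
      using x by (simp add: B_def special_orthogonal_iff matrix_mul_assoc)
    ultimately have skew: "transpose B = - B"
      by simp
    have "tuple_ad B (?f x) = 0"
      using b dmap_f[OF x skew] by (simp add: vertical_space_def b_eq)
    \<comment> \<open>Pairing the vanishing image of \<open>b\<close> with the image of
      \<open>A ** x\<close> gives twice the inner product of \<open>A\<close> and
      \<open>B\<close>.\<close>
    then have "B \<bullet> tuple_coad (tuple_ad A (?f x)) (?f x) = 0"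
      using tuple_ad_adjoint[of "?f x" B "tuple_ad A (?f x)"] resolutionD(1)[OF res[OF x]] by simp
    then have "A \<bullet> B = 0"
      by (simp add: tuple_coad_ad[OF res[OF x]] D inner_commute)
    then show "SO_metric x (A ** x) b = 0"
      unfolding metric[OF x] b_eq right[OF x] by simp
  qed
  obtain x where x: "x \<in> ?SO" "?f x = P"
    by (rule flag_action_transitive[OF sum_q P])
  note V = flag_velocity[OF v] and W = flag_velocity[OF w]
  have ex: "\<exists>x\<in>?SO. \<exists>a\<in>?hor x. \<exists>b\<in>?hor x.
      ?f x = P \<and> dmap ?SO ?f x a = v \<and> dmap ?SO ?f x b = w \<and> 1/4 * (v \<bullet> w) = SO_metric x a b"
  proof -
    let ?a = "flag_velocity P v ** x" and ?b = "flag_velocity P w ** x"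
    have hor: "?a \<in> ?hor x" "?b \<in> ?hor x"
      using horizontal[OF x(1)] x(2) V W by simp_all
    have dm: "dmap ?SO ?f x ?a = v" "dmap ?SO ?f x ?b = w"
      using dmap_f[OF x(1)] x(2) V W by simp_all
    show ?thesis
      using unique[OF x(1) hor dm refl] hor dm x by (intro bexI[of _ x] bexI[of _ ?a] bexI[of _ ?b]) simp_all
  qed
  show ?thesis
    unfolding flag_metric_def quotient_metric_def
    by (rule the_equality, rule ex, elim bexE conjE) (rule unique)
qed

lemma induced_metric_flag: "induced_metric F flag_proj (flag_metric q) (1/4)"
  by (intro induced_metric.intro induced_metric_axioms.intro projected_submanifold_flag
      flag_metric_eq) simp_all

end

text \<open>
  With \<open>a = ad A\<close>, \<open>b = ad B\<close> and \<open>c = [a, b]\<close>, this rewrites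
  \<open>\<langle>a\<^sup>2P, b\<^sup>2P\<rangle> - |(ab + ba)P|\<^sup>2/4\<close> as \<open>- \<langle>cbP, aP\<rangle> - |cP|\<^sup>2/4\<close>.
\<close>

lemma gauss_flag_algebra:
  fixes P :: "real^'n^'n^('r::finite)"
  assumes P: "resolution P" and A: "transpose A = - A" "block_diag P A = 0"
    and B: "transpose B = - B" "block_diag P B = 0"
  defines "C \<equiv> commutator A B"
  defines "S \<equiv> (1/2) *\<^sub>R (tuple_ad A (tuple_ad B P) + tuple_ad B (tuple_ad A P))"
  shows "tuple_ad A (tuple_ad A P) \<bullet> tuple_ad B (tuple_ad B P) - S \<bullet> S =
    1/2 * (C \<bullet> C) + 3/2 * (C \<bullet> block_diag P C)"
proof -
  let ?a = "tuple_ad A P" and ?b = "tuple_ad B P" and ?D = "block_diag P C"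
  let ?ab = "tuple_ad A ?b" and ?ba = "tuple_ad B ?a"
  have C: "tuple_ad C V = tuple_ad A (tuple_ad B V) - tuple_ad B (tuple_ad A V)" for V :: "real^'n^'n^'r"
    unfolding C_def by (rule tuple_ad_jacobi)
  \<comment> \<open>Move a across the inner product, exchange it with b at the cost of c, and move b
    back.\<close>
  have "tuple_ad A ?a \<bullet> tuple_ad B ?b = - (?a \<bullet> tuple_ad A (tuple_ad B ?b))"
    by (rule tuple_ad_skew[OF A(1)])
  also have "tuple_ad A (tuple_ad B ?b) = tuple_ad B ?ab + tuple_ad C ?b"
    by (simp add: C)
  also have "- (?a \<bullet> (tuple_ad B ?ab + tuple_ad C ?b)) = ?ba \<bullet> ?ab - tuple_ad C ?b \<bullet> ?a"
    using tuple_ad_skew[OF B(1), of ?a ?ab] by (simp add: inner_add_right inner_commute)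
  finally have 1: "tuple_ad A ?a \<bullet> tuple_ad B ?b = ?ba \<bullet> ?ab - tuple_ad C ?b \<bullet> ?a" .
  \<comment> \<open>Polarisation: |x + y|^2 / 4 = |x - y|^2 / 4 + x \<bullet> y with x =
    \<open>?ab\<close> and y = \<open>?ba\<close>; the mixed product cancels against the one in the
    previous identity.\<close>
  have 2: "S \<bullet> S = 1/4 * (tuple_ad C P \<bullet> tuple_ad C P) + ?ba \<bullet> ?ab"
    by (simp add: S_def C inner_add_left inner_add_right inner_diff_left inner_diff_right
        inner_commute algebra_simps)
  have "tuple_ad C P \<bullet> tuple_ad C P = C \<bullet> tuple_coad (tuple_ad C P) P"
    by (rule tuple_ad_adjoint) (rule resolutionD[OF P])
  then have 3: "tuple_ad C P \<bullet> tuple_ad C P = 2 * (C \<bullet> C - C \<bullet> ?D)"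
    by (simp add: tuple_coad_ad[OF P] inner_diff_right)
  \<comment> \<open>The adjoint formula is about to be applied with \<open>?b\<close> in the place
    of \<open>P\<close>, which requires symmetric components.\<close>
  have sym: "transpose (?b $ i) = ?b $ i" for i
    by (simp add: tuple_ad_def transpose_commutator resolutionD[OF P] B commutator.minus_right
        commutator_swap[of "P $ i"])
  have "tuple_ad C ?b \<bullet> ?a = C \<bullet> tuple_coad ?a ?b"
    by (rule tuple_ad_adjoint) (rule sym)
  also have "tuple_coad ?a ?b = commutator B A + block_diag P (commutator B A)"
    by (rule tuple_coad_ad_ad[OF P B(2) A(2)])
  also have "commutator B A = - C"
    unfolding C_def by (rule commutator_swap)
  finally have 4: "tuple_ad C ?b \<bullet> ?a = - (C \<bullet> C) - C \<bullet> ?D"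
    by (simp add: block_diag_minus inner_diff_right)
  show ?thesis
    unfolding 1 2 3 4 by (simp add: field_simps)
qed

lemma sum_commutator_sum:
  "(\<Sum>i\<in>I. \<Sum>j\<in>J. commutator (f i) (g j)) = commutator (\<Sum>i\<in>I. f i) (\<Sum>j\<in>J. g j)"
  unfolding commutator.sum_left by (simp add: commutator.sum_right)

theorem theorem3:
  fixes q :: "'r::{finite,linorder} \<Rightarrow> nat"
    and X Y :: "real^('n::{finite,linorder})^('n::{finite,linorder})^('r::{finite,linorder}) \<Rightarrow>
      real^('n::{finite,linorder})^('n::{finite,linorder})^('r::{finite,linorder})"
    and \<beta> :: "real^('n::{finite,linorder})^('n::{finite,linorder})^('r::{finite,linorder})"
  assumes "CARD('r) \<ge> 2"
    and "\<And>i. 0 < q i"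
    and "(\<Sum>i\<in>UNIV. q i) = CARD('n)"
    and "vector_field (flag_manifold q) X"
    and "vector_field (flag_manifold q) Y"
    and "\<beta> \<in> flag_manifold q"
  shows "flag_Omega X Y \<beta> \<in> skew_matrices \<and>
    sectional_curvature (flag_manifold q) (flag_metric q) X Y \<beta> =
      1/16 * ((skew_norm (flag_Omega X Y \<beta>))\<^sup>2
        - 3/16 * (skew_norm (\<Sum>i\<in>UNIV.
            commutator (commutator (flag_Omega X Y \<beta>) (\<beta> $ i)) (\<beta> $ i)))\<^sup>2)"
proof -
  note XY = assms(4,5) and \<beta> = assms(6)
  interpret induced_metric "flag_manifold q :: ('n, 'r) matrix_tuple set" flag_proj "flag_metric q" "1/4"
    by (rule induced_metric_flag[OF assms(3)])
  note res = resolution_flag[OF assms(3) \<beta>]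
  note X = vector_fieldD(2)[OF XY(1) \<beta>] and Y = vector_fieldD(2)[OF XY(2) \<beta>]
  define A where "A = flag_velocity \<beta> (X \<beta>)"
  define B where "B = flag_velocity \<beta> (Y \<beta>)"
  define C where "C = commutator A B"
  let ?D = "block_diag \<beta> C"
  note vA = flag_velocity[OF assms(3) X, folded A_def] and vB = flag_velocity[OF assms(3) Y, folded B_def]
  \<comment> \<open>By bilinearity the double sum is one commutator of two sums, and these are 2A
    and 2B.\<close>
  have \<Omega>: "flag_Omega X Y \<beta> = 4 *\<^sub>R C"
    unfolding flag_Omega_def sum_commutator_sum tuple_coad_def[symmetric] vA(4) vB(4)
    by (simp only: commutator.scaleR_left commutator.scaleR_right C_def) simp
  have skewC: "transpose C = - C"
    by (simp add: C_def transpose_commutator vA(2) vB(2) commutator.minus_left commutator.minus_right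
        commutator_swap[of B A])
  have sec: "II \<beta> v w = (1/2) *\<^sub>R (tuple_ad (flag_velocity \<beta> v) (tuple_ad (flag_velocity \<beta> w) \<beta>)
      + tuple_ad (flag_velocity \<beta> w) (tuple_ad (flag_velocity \<beta> v) \<beta>))"
    if "v \<in> tangent_space (flag_manifold q) \<beta>" "w \<in> tangent_space (flag_manifold q) \<beta>" for v w
    unfolding II_def by (rule flag_second_fundamental_form[OF assms(3) that])
  have K: "sectional_curvature (flag_manifold q) (flag_metric q) X Y \<beta> =
      1/4 * (1/2 * (C \<bullet> C) + 3/2 * (C \<bullet> ?D))"
    unfolding gauss_equation[OF XY \<beta>] sec[OF X X] sec[OF Y Y] sec[OF X Y] C_def
      A_def[symmetric] B_def[symmetric]
      gauss_flag_algebra[OF res vA(2,3) vB(2,3), symmetric]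
    by (simp flip: scaleR_2)
  have "?D \<bullet> ?D = C \<bullet> ?D"
    by (simp add: block_diag_adjoint[OF res, of C ?D] block_diag_idem[OF res])
  then have normD: "(C - ?D) \<bullet> (C - ?D) = C \<bullet> C - C \<bullet> ?D"
    by (simp add: inner_diff_left inner_diff_right inner_commute)
  have "(\<Sum>i\<in>UNIV. commutator (commutator (4 *\<^sub>R C) (\<beta> $ i)) (\<beta> $ i)) =
      4 *\<^sub>R tuple_coad (tuple_ad C \<beta>) \<beta>"
    by (simp add: tuple_coad_def tuple_ad_def commutator.scaleR_left scaleR_sum_right)
  also have "\<dots> = 8 *\<^sub>R (C - ?D)"
    unfolding tuple_coad_ad[OF res] scaleR_scaleR by simp
  finally have S: "(\<Sum>i\<in>UNIV. commutator (commutator (4 *\<^sub>R C) (\<beta> $ i)) (\<beta> $ i)) =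
      8 *\<^sub>R (C - ?D)" .
  \<comment> \<open>The coefficients are half of 16 and half of 64, from the factor 1/2 in
    \<open>skew_norm\<close>.\<close>
  have norms: "(skew_norm (4 *\<^sub>R C))\<^sup>2 = 8 * (C \<bullet> C)"
    "(skew_norm (8 *\<^sub>R (C - ?D)))\<^sup>2 = 32 * (C \<bullet> C - C \<bullet> ?D)"
    unfolding skew_norm_power2 inner_scaleR_left inner_scaleR_right normD by simp_all
  have "flag_Omega X Y \<beta> \<in> skew_matrices"
    unfolding \<Omega> skew_matrices_def mem_Collect_eq transpose_scalar skewC by (rule scaleR_minus_right)
  \<comment> \<open>Since 3/16 of 32 is 6, both sides equal (C \<bullet> C) / 8 + 3 (C \<bullet> ?D)
    / 8.\<close>
  then show ?thesis
    unfolding \<Omega> S norms K by (simp add: field_simps)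
qed

end
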